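(* Let $t$ be a positive integer. As formal power series in $x$: if $t=2t'$ is even, then $$\sum_{\lambda \in SC_{(t)}} \delta_\lambda \, x^{|\lambda|}=\prod_{k \geq 1} \frac{1-x^k}{1-x^{2k}}\left(1-x^{2kt}\right)^{t'},$$ and if $t=2t'+1$ is odd, then $$\sum_{\lambda \in SC_{(t)}} \delta_\lambda \, x^{|\lambda|}=\prod_{k \geq 1} \frac{1-x^k}{1-x^{2k}}\left(1-x^{2kt}\right)^{t'}\frac{1-x^{2kt}}{1-x^{kt}}.$$
   Context: A partition $\lambda$ is a finite non-increasing sequence of positive integers (possibly empty), with weight $|\lambda|$ equal to the sum of its parts. A partition is a $t$-core if none of the hook lengths of its boxes is a multiple of $t$. It is self-conjugate if it equals its conjugate (reflection of the Ferrers diagram in the principal diagonal). $SC_{(t)}$ is the set of self-conjugate $t$-cores (including the empty partition). $\delta_\lambda=(-1)^{D(\lambda)}$, where $D(\lambda)$ is the side length of the largest square contained in the Ferrers diagram of $\lambda$ (Durfee square). *)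

theory Defs
  imports "HOL-Analysis.Analysis" "HOL-Computational_Algebra.Formal_Power_Series"
begin

definition is_partition :: "nat list \<Rightarrow> bool" where
  "is_partition \<mu> \<longleftrightarrow> sorted_wrt (\<ge>) \<mu> \<and> (\<forall>p\<in>set \<mu>. p > 0)"

(* Boxes are (row, column), both counted from 0. *)
definition ferrers :: "nat list \<Rightarrow> (nat \<times> nat) set" where
  "ferrers \<mu> = {(i, j). i < length \<mu> \<and> j < \<mu> ! i}"

abbreviation weight :: "nat list \<Rightarrow> nat" where
  "weight \<mu> \<equiv> sum_list \<mu>"

(* The parts of the conjugate are the column lengths; the number of columns is
   the largest part. The lemmas below show that this is the partition whose diagram is
   the reflection of ferrers \<mu> in the principal diagonal. *)
definition conjugate :: "nat list \<Rightarrow> nat list" where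
  "conjugate \<mu> =
     map (\<lambda>j. card {i. (i, j) \<in> ferrers \<mu>}) [0..<(if \<mu> = [] then 0 else hd \<mu>)]"

definition self_conjugate :: "nat list \<Rightarrow> bool" where
  "self_conjugate \<mu> \<longleftrightarrow> conjugate \<mu> = \<mu>"

(* The hook of a box: the box itself, the boxes to its right in the same row, and the
   boxes below it in the same column. *)
definition hook :: "nat list \<Rightarrow> nat \<times> nat \<Rightarrow> (nat \<times> nat) set" where
  "hook \<mu> b = {(i, j) \<in> ferrers \<mu>.
     (i = fst b \<and> j \<ge> snd b) \<or> (j = snd b \<and> i \<ge> fst b)}"

definition hook_length :: "nat list \<Rightarrow> nat \<times> nat \<Rightarrow> nat" where
  "hook_length \<mu> b = card (hook \<mu> b)"

definition is_core :: "nat \<Rightarrow> nat list \<Rightarrow> bool" where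
  "is_core t \<mu> \<longleftrightarrow> is_partition \<mu> \<and> (\<forall>b\<in>ferrers \<mu>. \<not> t dvd hook_length \<mu> b)"

definition SC :: "nat \<Rightarrow> nat list set" where
  "SC t = {\<mu>. is_core t \<mu> \<and> self_conjugate \<mu>}"

definition durfee :: "nat list \<Rightarrow> nat" where
  "durfee \<mu> = Max {d. {..<d} \<times> {..<d} \<subseteq> ferrers \<mu>}"

definition durfee_sign :: "nat list \<Rightarrow> int" where
  "durfee_sign \<mu> = (-1) ^ durfee \<mu>"

lemma partition_nth_mono:
  assumes "is_partition \<mu>" "i \<le> k" "k < length \<mu>"
  shows "\<mu> ! k \<le> \<mu> ! i"
  using assms unfolding is_partition_def sorted_wrt_iff_nth_less
  by (cases "i = k") auto

lemma column_eq:
  assumes "is_partition \<mu>"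
  shows "{i. (i, j) \<in> ferrers \<mu>} = {..<card {i. (i, j) \<in> ferrers \<mu>}}"
proof -
  let ?C = "{i. (i, j) \<in> ferrers \<mu>}"
  have fin: "finite ?C"
    by (rule finite_subset[of _ "{..<length \<mu>}"]) (auto simp: ferrers_def)
  have down: "i \<in> ?C" if "k \<in> ?C" "i \<le> k" for i k
    using that partition_nth_mono[OF assms, of i k] by (auto simp: ferrers_def)
  have lt: "k < card ?C" if "k \<in> ?C" for k
  proof -
    have "card {..k} \<le> card ?C"
      using down[OF that] by (intro card_mono fin) auto
    then show ?thesis by simp
  qed
  have "?C \<subseteq> {..<card ?C}" using lt by blast
  then show ?thesis
    by (metis (no_types, lifting) card_lessThan card_subset_eq finite_lessThan)
qed

lemma ferrers_conjugate:
  assumes "is_partition \<mu>"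
  shows "ferrers (conjugate \<mu>) = prod.swap ` ferrers \<mu>"
proof -
  have "(j, i) \<in> ferrers (conjugate \<mu>) \<longleftrightarrow> (i, j) \<in> ferrers \<mu>" for i j
  proof -
    have width: "j < (if \<mu> = [] then 0 else hd \<mu>)" if "(i, j) \<in> ferrers \<mu>"
      using that partition_nth_mono[OF assms, of 0 i]
      by (cases \<mu>) (auto simp: ferrers_def)
    have col: "(i, j) \<in> ferrers \<mu> \<longleftrightarrow> i < card {i. (i, j) \<in> ferrers \<mu>}"
      using column_eq[OF assms, of j] by blast
    have "(j, i) \<in> ferrers (conjugate \<mu>) \<longleftrightarrow>
        j < (if \<mu> = [] then 0 else hd \<mu>) \<and> i < card {i. (i, j) \<in> ferrers \<mu>}"
      by (subst ferrers_def) (auto simp: conjugate_def split: if_splits)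
    with width col show ?thesis by blast
  qed
  then show ?thesis by (auto simp: image_iff) (metis swap_simp)+
qed

lemma partition_conjugate:
  assumes "is_partition \<mu>"
  shows "is_partition (conjugate \<mu>)"
proof -
  have fin: "finite {i. (i, j) \<in> ferrers \<mu>}" for j
    by (rule finite_subset[of _ "{..<length \<mu>}"]) (auto simp: ferrers_def)
  have mono: "card {i. (i, k) \<in> ferrers \<mu>} \<le> card {i. (i, j) \<in> ferrers \<mu>}"
    if "j < k" for j k
    using that by (intro card_mono fin) (auto simp: ferrers_def)
  have pos: "0 < card {i. (i, j) \<in> ferrers \<mu>}" if "\<mu> \<noteq> []" "j < hd \<mu>" for j
  proof -
    have "0 \<in> {i. (i, j) \<in> ferrers \<mu>}"
      using that by (auto simp: ferrers_def hd_conv_nth)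
    then show ?thesis using fin card_gt_0_iff by blast
  qed
  show ?thesis
    unfolding is_partition_def conjugate_def
    by (auto simp: sorted_wrt_iff_nth_less mono pos)
qed

end

(* The diagonal hook lengths of a self-conjugate partition form a finite set D of odd positive
   integers with weight \<Sum>D and Durfee square side card D, and every such D occurs. With
   b i = 2 (l i - i) - 1, where l i is the i-th part (zero beyond the end), the hook of a box (i, j)
   has length (b i + b j) / 2, and the set B of all b i contains exactly one of x and -x for each
   odd x. Hence the partition is a t-core iff B is closed under subtracting 2t, which constrains D
   separately on each pair of residue classes r, -r modulo 2t. For odd r < t the admissible parts of
   D in the pair {r, -r} are indexed by an integer c, with sign (-1)^c and weight r c + t c (c - 1),
   so the Jacobi triple product evaluates their generating function; the class of t contributes
   nothing. The odd factors left over are collected by Euler's product of 1 - X^(2k+1).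
   All limits are replaced by congruences modulo X^n that hold for the n-th partial products. *)
theory Submission
  imports Defs
begin

section \<open>Self-conjugate partitions and diagonal hooks\<close>

text \<open>A hook length divisible by \<open>t\<close> says b i - 2 t m = - b j for some m > 0, and
  this number is missing from B because b j is present; that is how a condition on boxes becomes a
  closure condition on B. For odd \<open>t\<close> the residue class of \<open>t\<close> is its own
  mirror image, and an element of D in it would force both t and - t into B. The odd exponents t (2
  k + 1) are therefore missing from the product over the other classes; removing them from the
  product over all odd exponents, by Euler's product in X^t, yields the extra factor of the odd
  case. The triple product is used with A = X^r and B = X^(2t - r), so that A B = X^(2t) does not
  depend on the class. It is first proved as an exact finite identity with Gaussian binomials, where
  no limit occurs.\<close>

definition row_len :: "nat list \<Rightarrow> nat \<Rightarrow> nat" where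
  "row_len l i = (if i < length l then l ! i else 0)"

lemma down_closed_eq_lessThan:
  assumes fin: "finite K" and down: "\<And>k i. k \<in> K \<Longrightarrow> i \<le> k \<Longrightarrow> i \<in> K"
  shows "K = {..<card K}"
proof -
  have "K \<subseteq> {..<card K}"
  proof
    fix k assume "k \<in> K"
    then have "{..k} \<subseteq> K" using down by auto
    from card_mono[OF fin this] show "k \<in> {..<card K}" by simp
  qed
  then show ?thesis by (intro card_subset_eq) auto
qed

lemma mem_ferrers_iff: "(i, j) \<in> ferrers l \<longleftrightarrow> j < row_len l i"
  by (auto simp: ferrers_def row_len_def)

lemma card_ferrers: "card (ferrers l) = weight l"
proof -
  have "ferrers l = Sigma {..<length l} (\<lambda>i. {..<l ! i})"
    by (auto simp: ferrers_def)
  then have "card (ferrers l) = (\<Sum>i<length l. l ! i)" by simp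
  then show ?thesis by (simp add: sum_list_sum_nth atLeast0LessThan)
qed

lemma row_len_antimono: "is_partition l \<Longrightarrow> i \<le> k \<Longrightarrow> row_len l k \<le> row_len l i"
  using partition_nth_mono[of l i k] by (auto simp: row_len_def)

lemma partition_eqI:
  assumes l: "is_partition l" and m: "is_partition m" and eq: "ferrers l = ferrers m"
  shows "l = m"
proof -
  have row: "row_len l i = row_len m i" for i
    using eq by (metis mem_ferrers_iff linorder_neqE_nat less_irrefl)
  have pos: "i < length n \<longleftrightarrow> 0 < row_len n i" if "is_partition n" for n i
    using that by (auto simp: row_len_def is_partition_def)
  have len: "length l = length m"
    using pos[OF l] pos[OF m] row by (metis linorder_neqE_nat less_irrefl)
  show ?thesis
    using len row by (intro nth_equalityI) (auto simp: row_len_def split: if_splits, metis)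
qed

lemma partition_of_diagram:
  assumes fin: "finite F"
    and down: "\<And>i j i' j'. (i, j) \<in> F \<Longrightarrow> i' \<le> i \<Longrightarrow> j' \<le> j \<Longrightarrow> (i', j') \<in> F"
  shows "\<exists>l. is_partition l \<and> ferrers l = F"
proof -
  define c where "c i = card {j. (i, j) \<in> F}" for i
  have fin1: "finite {j. (i, j) \<in> F}" for i
    by (rule finite_subset[of _ "snd ` F"]) (use fin in \<open>force+\<close>)
  have c: "(i, j) \<in> F \<longleftrightarrow> j < c i" for i j
    using down_closed_eq_lessThan[OF fin1[of i]] down by (auto simp: c_def)
  define h where "h = card {i. (i, 0) \<in> F}"
  have fin2: "finite {i. (i, 0) \<in> F}"
    by (rule finite_subset[of _ "fst ` F"]) (use fin in \<open>force+\<close>)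
  have h: "0 < c i \<longleftrightarrow> i < h" for i
    using down_closed_eq_lessThan[OF fin2] down by (auto simp: h_def simp flip: c)
  have mono: "c k \<le> c i" if "i \<le> k" for i k
  proof (rule ccontr)
    assume "\<not> c k \<le> c i"
    then have "(k, c i) \<in> F" using c by simp
    then have "(i, c i) \<in> F" using down that by blast
    then show False using c by simp
  qed
  have "is_partition (map c [0..<h])"
    unfolding is_partition_def sorted_wrt_iff_nth_less
    by (simp add: h) (simp add: mono)
  moreover have "(i, j) \<in> ferrers (map c [0..<h]) \<longleftrightarrow> (i, j) \<in> F" for i j
    using h[of i] unfolding c by (auto simp: ferrers_def)
  then have "ferrers (map c [0..<h]) = F" by auto
  ultimately show ?thesis by blast
qed

lemma self_conjugate_iff:
  assumes "is_partition l"
  shows "self_conjugate l \<longleftrightarrow> (\<forall>i j. (i, j) \<in> ferrers l \<longleftrightarrow> (j, i) \<in> ferrers l)"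
proof -
  have "self_conjugate l \<longleftrightarrow> ferrers (conjugate l) = ferrers l"
    using partition_eqI[OF partition_conjugate[OF assms] assms]
    by (auto simp: self_conjugate_def)
  also have "\<dots> \<longleftrightarrow> prod.swap ` ferrers l = ferrers l"
    by (simp add: ferrers_conjugate assms)
  also have "\<dots> \<longleftrightarrow> (\<forall>i j. (i, j) \<in> ferrers l \<longleftrightarrow> (j, i) \<in> ferrers l)"
    by (auto simp: image_iff set_eq_iff) (metis swap_simp)+
  finally show ?thesis .
qed

section \<open>Beads of a self-conjugate partition\<close>

locale self_conj_partition =
  fixes l :: "nat list"
  assumes part: "is_partition l" and self_conj: "self_conjugate l"
begin

lemma sym: "j < row_len l i \<longleftrightarrow> i < row_len l j"
  using self_conj unfolding self_conjugate_iff[OF part] mem_ferrers_iff by blast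

text \<open>Twice the half-integral positions of the Maya diagram; \<open>i\<close> also runs through the empty rows.\<close>
definition bead :: "nat \<Rightarrow> int" where
  "bead i = 2 * (int (row_len l i) - int i) - 1"

lemma bead_strict_antimono: "i < k \<Longrightarrow> bead k < bead i"
  using row_len_antimono[OF part, of i k] by (simp add: bead_def)

lemma odd_bead: "odd (bead i)"
  by (simp add: bead_def)

text \<open>Over the integers the sum is
  \<open>2 * ((row_len l i - j) + (row_len l j - i) - 1)\<close>. By symmetry the two differences
  are both positive or both at most 0, so the sum is also never 0.\<close>

lemma bead_sum_pos_iff: "bead i + bead j > 0 \<longleftrightarrow> j < row_len l i"
  using sym[of j i] by (auto simp: bead_def)

text \<open>By symmetry column \<open>j\<close> has length \<open>row_len l j\<close>, so the arm
  and the leg are both read off row lengths.\<close>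

lemma hook_length_eq:
  assumes "(i, j) \<in> ferrers l"
  shows "2 * int (hook_length l (i, j)) = bead i + bead j"
proof -
  from assms have ij: "j < row_len l i" "i < row_len l j"
    using sym by (auto simp: mem_ferrers_iff)
  have "hook l (i, j) = {i} \<times> {j..<row_len l i} \<union> {Suc i..<row_len l j} \<times> {j}"
    using ij sym by (auto simp: hook_def mem_ferrers_iff)
  moreover have "card ({i} \<times> {j..<row_len l i} \<union> {Suc i..<row_len l j} \<times> {j})
      = card ({i} \<times> {j..<row_len l i}) + card ({Suc i..<row_len l j} \<times> {j})"
    by (rule card_Un_disjoint) auto
  ultimately have "hook_length l (i, j) = (row_len l i - j) + (row_len l j - Suc i)"
    by (simp add: hook_length_def)
  then show ?thesis using ij by (simp add: bead_def)
qed

text \<open>Let \<open>c\<close> be the first row whose box on the diagonal of content \<open>k\<close> is missing. Either row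
  \<open>c + k\<close> has length \<open>c\<close>, which gives the bead \<open>- (2 * k + 1)\<close>, or row \<open>c - 1\<close> has length
  \<open>c + k\<close>, which gives the bead \<open>2 * k + 1\<close>.\<close>
lemma bead_complement: "- (2 * int k + 1) \<in> range bead \<longleftrightarrow> 2 * int k + 1 \<notin> range bead"
proof -
  have "2 * int k + 1 \<notin> range bead" if neg: "- (2 * int k + 1) \<in> range bead"
  proof
    assume "2 * int k + 1 \<in> range bead"
    then obtain j where "2 * int k + 1 = bead j" by (rule rangeE)
    moreover obtain i where "- (2 * int k + 1) = bead i" by (rule rangeE[OF neg])
    ultimately have "bead i + bead j = 0" by simp
    then show False using sym[of j i] by (auto simp: bead_def)
  qed
  moreover have "2 * int k + 1 \<in> range bead" if "- (2 * int k + 1) \<notin> range bead"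
  proof -
    have "\<exists>i. row_len l i \<le> i + k"
      using row_len_antimono[OF part, of 0 "row_len l 0"] by (meson le0 trans_le_add1)
    define c where "c = (LEAST i. row_len l i \<le> i + k)"
    have c: "row_len l c \<le> c + k"
      unfolding c_def by (rule LeastI_ex) fact
    have "row_len l (c + k) \<le> c" using c sym[of "c + k" c] by auto
    moreover have "row_len l (c + k) \<noteq> c"
    proof
      assume "row_len l (c + k) = c"
      then have "bead (c + k) = - (2 * int k + 1)" by (simp add: bead_def)
      with that show False using rangeI[of bead "c + k"] by simp
    qed
    ultimately have less: "row_len l (c + k) < c" by simp
    then obtain i where i: "c = Suc i" by (cases c) auto
    have "row_len l i > i + k"
      using not_less_Least[of i "\<lambda>i. row_len l i \<le> i + k"] i by (simp add: c_def)
    moreover have "row_len l i \<le> Suc (i + k)"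
      using less sym[of "c + k" i] i by auto
    ultimately have "bead i = 2 * int k + 1" by (simp add: bead_def)
    then show ?thesis using rangeI[of bead i] by simp
  qed
  ultimately show ?thesis by blast
qed

text \<open>By \<open>bead_sum_pos_iff\<close> and \<open>hook_length_eq\<close> with
  \<open>j = i\<close>, the positive beads are the hook lengths of the diagonal boxes.\<close>

definition diag_hooks :: "nat set" where
  "diag_hooks = {d. int d \<in> range bead}"

lemma odd_diag_hooks: "d \<in> diag_hooks \<Longrightarrow> odd d"
proof -
  assume "d \<in> diag_hooks"
  then have "int d \<in> range bead" by (simp add: diag_hooks_def)
  then obtain i where "int d = bead i" by (rule rangeE)
  then have "odd (int d)" using odd_bead by simp
  then show "odd d" by simp
qed

text \<open>The right side says \<open>bead i \<ge> 2 * k + 1\<close>. The indices satisfying it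
  form an initial segment, because rows shrink, and distinct indices have distinct beads; so the
  segment is as long as the number of diagonal hooks counted on the left.\<close>

lemma diag_hooks_ge_iff:
  "i < card {d \<in> diag_hooks. 2 * k + 1 \<le> d} \<longleftrightarrow> i + k < row_len l i"
proof -
  let ?I = "{i. i + k < row_len l i}"
  have "?I \<subseteq> {..<row_len l 0}"
  proof
    fix i assume "i \<in> ?I"
    then show "i \<in> {..<row_len l 0}" using row_len_antimono[OF part, of 0 i] by simp
  qed
  then have fin: "finite ?I" by (rule finite_subset) simp
  have bij: "bij_betw (\<lambda>i. nat (bead i)) ?I {d \<in> diag_hooks. 2 * k + 1 \<le> d}"
  proof (rule bij_betwI')
    fix x y assume "x \<in> ?I" "y \<in> ?I"
    then have "bead x > 0" "bead y > 0" by (auto simp: bead_def)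
    then show "nat (bead x) = nat (bead y) \<longleftrightarrow> x = y"
      using bead_strict_antimono[of x y] bead_strict_antimono[of y x]
      by (cases x y rule: linorder_cases) auto
  next
    fix x assume "x \<in> ?I"
    then show "nat (bead x) \<in> {d \<in> diag_hooks. 2 * k + 1 \<le> d}"
      by (auto simp: diag_hooks_def bead_def)
  next
    fix d assume "d \<in> {d \<in> diag_hooks. 2 * k + 1 \<le> d}"
    then obtain i where "int d = bead i" "2 * k + 1 \<le> d" by (auto simp: diag_hooks_def)
    then show "\<exists>x\<in>?I. d = nat (bead x)"
      by (intro bexI[of _ i]) (auto simp: bead_def)
  qed
  have down: "i \<in> ?I" if "m \<in> ?I" "i \<le> m" for i m
    using that row_len_antimono[OF part that(2)] by auto
  have "?I = {..<card ?I}" using fin down by (rule down_closed_eq_lessThan)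
  then have "i < card ?I \<longleftrightarrow> i \<in> ?I" by blast
  then show ?thesis using bij_betw_same_card[OF bij] by simp
qed

lemma finite_diag_hooks: "finite diag_hooks"
proof (rule finite_subset)
  show "diag_hooks \<subseteq> {..nat (bead 0)}"
  proof
    fix d assume "d \<in> diag_hooks"
    then obtain i where "int d = bead i" by (auto simp: diag_hooks_def)
    moreover have "bead i \<le> bead 0" using bead_strict_antimono[of 0 i] by (cases i) auto
    ultimately show "d \<in> {..nat (bead 0)}" by simp
  qed
qed simp

end

text \<open>The box \<open>(i, j)\<close> lies in the diagram iff the diagonal hook number \<open>min i j\<close> (counted from 0, in
  decreasing order of length) reaches content \<open>j - i\<close>.\<close>
definition diagram :: "nat set \<Rightarrow> (nat \<times> nat) set" where
  "diagram D = {(i, j). min i j < card {d \<in> D. 2 * (max i j - min i j) + 1 \<le> d}}"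

context self_conj_partition
begin

lemma diagram_diag_hooks: "diagram diag_hooks = ferrers l"
proof -
  have "(i, j) \<in> diagram diag_hooks \<longleftrightarrow> (i, j) \<in> ferrers l" for i j
  proof (cases "i \<le> j")
    case True
    then show ?thesis
      using diag_hooks_ge_iff[of i "j - i"] by (simp add: diagram_def mem_ferrers_iff)
  next
    case False
    then show ?thesis
      using diag_hooks_ge_iff[of j "i - j"] sym[of i j] by (simp add: diagram_def mem_ferrers_iff)
  qed
  then show ?thesis by auto
qed

end

text \<open>No odd number lies strictly between \<open>2 * k + 1\<close> and
  \<open>2 * k + 3\<close>, so raising the threshold loses at most one element. The size of the drop
  detects membership in \<open>diagram_inj\<close>; its bound by 1 gives the shape in
  \<open>diagram_down\<close>.\<close>

lemma card_filter_ge_Suc: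
  assumes D: "finite D" "\<And>d. d \<in> D \<Longrightarrow> odd (d::nat)"
  shows "card {d \<in> D. 2 * k + 1 \<le> d} = (if 2 * k + 1 \<in> D then 1 else 0) + card {d \<in> D. 2 * Suc k + 1 \<le> d}"
proof -
  have s: "card {d \<in> D. d = n} = (if n \<in> D then 1 else 0)" for n
  proof -
    have "{d \<in> D. d = n} = (if n \<in> D then {n} else {})" by auto
    then show ?thesis by simp
  qed
  have ge: "2 * k + 1 \<le> d \<longleftrightarrow> d = 2 * k + 1 \<or> 2 * Suc k + 1 \<le> d" if "d \<in> D" for d
    using D(2)[OF that] by presburger
  have eq: "{d \<in> D. 2 * k + 1 \<le> d} = {d \<in> D. d = 2 * k + 1} \<union> {d \<in> D. 2 * Suc k + 1 \<le> d}"
    using ge by blast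
  have "card ({d \<in> D. d = 2 * k + 1} \<union> {d \<in> D. 2 * Suc k + 1 \<le> d}) = card {d \<in> D. d = 2 * k + 1} + card {d \<in> D. 2 * Suc k + 1 \<le> d}"
    by (rule card_Un_disjoint) (use D in auto)
  then show ?thesis by (simp only: eq s)
qed

lemma diagram_inj:
  assumes D: "finite D" "\<And>d. d \<in> D \<Longrightarrow> odd d" and E: "finite E" "\<And>d. d \<in> E \<Longrightarrow> odd d"
    and eq: "diagram D = diagram E"
  shows "D = E"
proof -
  have card: "card {d \<in> D. 2 * k + 1 \<le> d} = card {d \<in> E. 2 * k + 1 \<le> d}" for k
  proof -
    have "i < card {d \<in> D. 2 * k + 1 \<le> d} \<longleftrightarrow> i < card {d \<in> E. 2 * k + 1 \<le> d}" for i
    proof -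
      have "(i, i + k) \<in> diagram D \<longleftrightarrow> (i, i + k) \<in> diagram E" using eq by simp
      then show ?thesis by (simp add: diagram_def)
    qed
    then show ?thesis by (metis linorder_neqE_nat less_irrefl)
  qed
  have "2 * k + 1 \<in> D \<longleftrightarrow> 2 * k + 1 \<in> E" for k
    using card_filter_ge_Suc[OF D, of k] card_filter_ge_Suc[OF E, of k] card[of k] card[of "Suc k"]
    by (auto split: if_splits)
  then show ?thesis using D(2) E(2) by (metis oddE subsetI subset_antisym)
qed

lemma diagram_sym: "(i, j) \<in> diagram D \<longleftrightarrow> (j, i) \<in> diagram D"
  by (simp add: diagram_def min.commute max.commute)

text \<open>A step to the left on or above the diagonal lowers the threshold, so the count can only
  grow. Below the diagonal the threshold rises, but the count drops by at most 1 while
  \<open>min i j\<close> drops by exactly 1. Vertical steps follow by transposition.\<close>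

lemma diagram_down:
  assumes D: "finite D" "\<And>d. d \<in> D \<Longrightarrow> odd d"
    and "(i, j) \<in> diagram D" "i' \<le> i" "j' \<le> j"
  shows "(i', j') \<in> diagram D"
proof -
  have left: "(i, j) \<in> diagram D" if "(i, Suc j) \<in> diagram D" for i j
  proof (cases "i \<le> j")
    case True
    have "card {d \<in> D. 2 * (Suc j - i) + 1 \<le> d} \<le> card {d \<in> D. 2 * (j - i) + 1 \<le> d}"
      by (rule card_mono) (use D in auto)
    then show ?thesis using that True by (simp add: diagram_def max_def min_def split: if_splits)
  next
    case False
    then have *: "Suc (i - Suc j) = i - j" by auto
    from card_filter_ge_Suc[OF D, of "i - Suc j"] show ?thesis
      using that False unfolding * by (auto simp: diagram_def max_def min_def split: if_splits)
  qed
  have 1: "(i, j - k) \<in> diagram D" if "(i, j) \<in> diagram D" for i j k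
    using that
  proof (induction k)
    case (Suc k)
    then show ?case
      using left[of i "j - Suc k"] by (cases "k < j") (auto simp: Suc_diff_Suc)
  qed simp
  have "(i, j') \<in> diagram D" using 1[of i j "j - j'"] assms by simp
  then have "(j', i) \<in> diagram D" using diagram_sym by blast
  then have "(j', i') \<in> diagram D" using 1[of j' i "i - i'"] assms by simp
  then show ?thesis using diagram_sym by blast
qed

text \<open>Boxes are counted by content \<open>k = j - i\<close>: their number is that of the
  \<open>d\<close> with \<open>d \<ge> 2 * \<bar>k\<bar> + 1\<close>. After exchanging the sums, an
  odd \<open>d\<close> is counted once for each \<open>k\<close> with
  \<open>\<bar>k\<bar> \<le> (d - 1) div 2\<close>, that is, \<open>d\<close> times.\<close>

lemma card_diagram:
  assumes D: "finite D" "\<And>d. d \<in> D \<Longrightarrow> odd d"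
  shows "finite (diagram D)" "card (diagram D) = \<Sum>D"
proof -
  define S where "S = Sigma D (\<lambda>d. {k::int. 2 * nat \<bar>k\<bar> + 1 \<le> d})"
  define T where "T = Sigma {k::int. 2 * nat \<bar>k\<bar> + 1 \<le> Max D} (\<lambda>k. {..<card {d \<in> D. 2 * nat \<bar>k\<bar> + 1 \<le> d}})"
  have K: "{k::int. 2 * nat \<bar>k\<bar> + 1 \<le> n} = {- ((int n - 1) div 2)..(int n - 1) div 2}" for n
    by (auto; presburger)
  have fK: "finite {k::int. 2 * nat \<bar>k\<bar> + 1 \<le> n}" for n unfolding K by simp
  have fT: "finite T" unfolding T_def by (intro finite_SigmaI fK) simp
  have bij: "bij_betw (\<lambda>(k, m). (m + nat (- k), m + nat k)) T (diagram D)"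
  proof (rule bij_betw_byWitness[where f' = "\<lambda>(i, j). (int j - int i, min i j)"])
    show "\<forall>a\<in>T. (case case a of (k, m) \<Rightarrow> (m + nat (- k), m + nat k) of (i, j) \<Rightarrow> (int j - int i, min i j)) = a"
      by auto
    show "\<forall>a'\<in>diagram D. (case case a' of (i, j) \<Rightarrow> (int j - int i, min i j) of (k, m) \<Rightarrow> (m + nat (- k), m + nat k)) = a'"
      by auto
    show "(\<lambda>(k, m). (m + nat (- k), m + nat k)) ` T \<subseteq> diagram D"
    proof clarify
      fix k :: int and m assume "(k, m) \<in> T"
      moreover have "max (m + nat (- k)) (m + nat k) - min (m + nat (- k)) (m + nat k) = nat \<bar>k\<bar>"
        "min (m + nat (- k)) (m + nat k) = m" by auto
      ultimately show "(m + nat (- k), m + nat k) \<in> diagram D" by (simp add: T_def diagram_def)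
    qed
    show "(\<lambda>(i, j). (int j - int i, min i j)) ` diagram D \<subseteq> T"
    proof clarify
      fix i j assume ij: "(i, j) \<in> diagram D"
      have *: "max i j - min i j = nat \<bar>int j - int i\<bar>" by auto
      with ij have **: "min i j < card {d \<in> D. 2 * nat \<bar>int j - int i\<bar> + 1 \<le> d}"
        by (simp add: diagram_def)
      then have "{d \<in> D. 2 * nat \<bar>int j - int i\<bar> + 1 \<le> d} \<noteq> {}" by (metis card.empty not_less0)
      then have "2 * nat \<bar>int j - int i\<bar> + 1 \<le> Max D"
        using D(1) by (auto intro: order_trans[OF _ Max_ge])
      then show "(int j - int i, min i j) \<in> T" using ** by (simp add: T_def)
    qed
  qed
  show "finite (diagram D)" using bij fT by (simp add: bij_betw_finite)
  have "card (diagram D) = card T" using bij_betw_same_card[OF bij] by simp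
  also have "\<dots> = (\<Sum>k\<in>{k::int. 2 * nat \<bar>k\<bar> + 1 \<le> Max D}. card {d \<in> D. 2 * nat \<bar>k\<bar> + 1 \<le> d})"
    unfolding T_def by (subst card_SigmaI) (use fK in auto)
  also have "\<dots> = (\<Sum>k\<in>{k::int. 2 * nat \<bar>k\<bar> + 1 \<le> Max D}. \<Sum>d\<in>D. if 2 * nat \<bar>k\<bar> + 1 \<le> d then 1 else 0)"
    using D(1) by (simp add: sum.If_cases Int_def)
  also have "\<dots> = (\<Sum>d\<in>D. \<Sum>k\<in>{k::int. 2 * nat \<bar>k\<bar> + 1 \<le> Max D}. if 2 * nat \<bar>k\<bar> + 1 \<le> d then 1 else 0)"
    by (rule sum.swap)
  also have "\<dots> = (\<Sum>d\<in>D. d)"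
  proof (intro sum.cong refl)
    fix d assume d: "d \<in> D"
    then have "d \<le> Max D" using D(1) by simp
    then have *: "{k::int. 2 * nat \<bar>k\<bar> + 1 \<le> Max D} \<inter> {k. 2 * nat \<bar>k\<bar> + 1 \<le> d} = {k. 2 * nat \<bar>k\<bar> + 1 \<le> d}"
      by auto
    have "(\<Sum>k\<in>{k::int. 2 * nat \<bar>k\<bar> + 1 \<le> Max D}. if 2 * nat \<bar>k\<bar> + 1 \<le> d then 1 else 0)
      = card ({k::int. 2 * nat \<bar>k\<bar> + 1 \<le> Max D} \<inter> {k. 2 * nat \<bar>k\<bar> + 1 \<le> d})"
      by (subst sum.If_cases[OF fK]) simp
    also have "\<dots> = card {k::int. 2 * nat \<bar>k\<bar> + 1 \<le> d}"
      by (simp only: *)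
    also have "\<dots> = d" unfolding K using D(2)[OF d] by (auto elim!: oddE)
    finally show "(\<Sum>k\<in>{k::int. 2 * nat \<bar>k\<bar> + 1 \<le> Max D}. if 2 * nat \<bar>k\<bar> + 1 \<le> d then 1 else 0) = d" .
  qed
  finally show "card (diagram D) = \<Sum>D" .
qed

text \<open>Closure of the beads under subtracting \<open>2 * t\<close>, expressed by the positive beads alone: a negative
  bead \<open>- d\<close> is present iff \<open>d\<close> is not.\<close>
definition hook_core :: "nat \<Rightarrow> nat set \<Rightarrow> bool" where
  "hook_core t D \<longleftrightarrow> (\<forall>d\<in>D. (2 * t < d \<longrightarrow> d - 2 * t \<in> D) \<and> (d < 2 * t \<longrightarrow> 2 * t - d \<notin> D))"

context self_conj_partition
begin

lemma bead_iff:
  "odd b \<Longrightarrow> b \<in> range bead \<longleftrightarrow> (if b > 0 then nat b \<in> diag_hooks else nat (- b) \<notin> diag_hooks)"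
proof -
  assume b: "odd b"
  show ?thesis
  proof (cases "b > 0")
    case True
    then show ?thesis by (simp add: diag_hooks_def)
  next
    case False
    obtain m where m: "b = 2 * m + 1" using b by (rule oddE)
    define k where "k = nat (- m - 1)"
    have k: "- b = 2 * int k + 1" using m False by (simp add: k_def)
    then have "b = - (2 * int k + 1)" "nat (- b) = 2 * k + 1" by simp_all
    then show ?thesis using bead_complement[of k] False
      by (simp add: diag_hooks_def add.commute)
  qed
qed

lemma bead_uminus_iff:
  assumes "odd b"
  shows "- b \<in> range bead \<longleftrightarrow> b \<notin> range bead"
proof -
  have "b \<noteq> 0" using assms by auto
  then consider "b > 0" | "b < 0" by linarith
  then show ?thesis
    using bead_iff[OF assms] bead_iff[of "- b"] assms by cases simp_all
qed

text \<open>Closure under one subtraction of \<open>2 * t\<close> gives closure under every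
  multiple, which excludes all hook lengths divisible by \<open>t\<close>. Conversely, if
  \<open>bead i - 2 * int t\<close> is missing, its negative is a bead, and the two beads give a
  hook of length exactly \<open>t\<close>.\<close>

lemma is_core_iff:
  assumes t: "t > 0"
  shows "is_core t l \<longleftrightarrow> hook_core t diag_hooks"
proof -
  have "is_core t l \<longleftrightarrow> (\<forall>i j. bead i + bead j > 0 \<longrightarrow> \<not> int (2 * t) dvd bead i + bead j)"
  proof -
    have "t dvd hook_length l (i, j) \<longleftrightarrow> int (2 * t) dvd bead i + bead j" if "(i, j) \<in> ferrers l" for i j
      using hook_length_eq[OF that, symmetric] by (simp add: int_dvd_int_iff)
    then show ?thesis
      using part unfolding is_core_def bead_sum_pos_iff mem_ferrers_iff[symmetric] by auto
  qed
  also have "\<dots> \<longleftrightarrow> (\<forall>b\<in>range bead. b - 2 * int t \<in> range bead)"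
  proof safe
    fix i
    assume *: "\<forall>i j. bead i + bead j > 0 \<longrightarrow> \<not> int (2 * t) dvd bead i + bead j"
    show "bead i - 2 * int t \<in> range bead"
    proof (rule ccontr)
      assume n: "bead i - 2 * int t \<notin> range bead"
      have "odd (bead i - 2 * int t)" using odd_bead[of i] by simp
      then have "- (bead i - 2 * int t) \<in> range bead"
        using n bead_uminus_iff by blast
      then obtain j where "bead j = - (bead i - 2 * int t)" by force
      then have "bead i + bead j = int (2 * t)" by simp
      then show False using *[rule_format, of i j] t by simp
    qed
  next
    fix i j
    assume *: "\<forall>b\<in>range bead. b - 2 * int t \<in> range bead"
      and "bead i + bead j > 0" "int (2 * t) dvd bead i + bead j"
    then obtain m where m: "bead i + bead j = int (2 * t) * m" "m > 0"
      using t by (auto elim!: dvdE simp: zero_less_mult_iff)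
    have "bead i - 2 * int t * int n \<in> range bead" for n
    proof (induction n)
      case (Suc n)
      with * have "bead i - 2 * int t * int n - 2 * int t \<in> range bead" by blast
      then show ?case by (simp add: algebra_simps)
    qed simp
    moreover have "bead i - 2 * int t * int (nat m) = - bead j"
      using m by (simp add: algebra_simps)
    ultimately have "- bead j \<in> range bead" by metis
    then show False using bead_uminus_iff[OF odd_bead] by blast
  qed
  also have "\<dots> \<longleftrightarrow> hook_core t diag_hooks"
  proof
    assume *: "\<forall>b\<in>range bead. b - 2 * int t \<in> range bead"
    show "hook_core t diag_hooks"
      unfolding hook_core_def
    proof (intro ballI conjI impI)
      fix d assume d: "d \<in> diag_hooks"
      then have b: "int d - 2 * int t \<in> range bead" using * by (auto simp: diag_hooks_def)
      have o: "odd (int d - 2 * int t)" using odd_diag_hooks[OF d] by simp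
      show "d - 2 * t \<in> diag_hooks" if "2 * t < d"
        using b that by (simp add: diag_hooks_def of_nat_diff)
      show "2 * t - d \<notin> diag_hooks" if "d < 2 * t"
      proof -
        have "nat (- (int d - 2 * int t)) = 2 * t - d" using that by auto
        then show ?thesis using b that bead_iff[OF o] by simp
      qed
    qed
  next
    assume *: "hook_core t diag_hooks"
    show "\<forall>b\<in>range bead. b - 2 * int t \<in> range bead"
    proof
      fix b assume b: "b \<in> range bead"
      then have o: "odd b" "odd (b - 2 * int t)" using odd_bead by auto
      note i1 = bead_iff[OF o(1)] and i2 = bead_iff[OF o(2)]
      \<comment> \<open>Parity excludes 0 and \<open>2 * t\<close>. The signs of \<open>b\<close>
        and \<open>b - 2 * int t\<close> decide which half of \<open>hook_core\<close> applies; when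
        both are negative, the complement rule makes it the contrapositive of the first
        half.\<close>
      consider "b > 2 * int t" | "0 < b" "b < 2 * int t" | "b < 0"
        using o by (metis dvd_triv_left even_zero linorder_neqE)
      then show "b - 2 * int t \<in> range bead"
      proof cases
        case 1
        then have "nat b \<in> diag_hooks" "2 * t < nat b" using b i1 by auto
        then have "nat b - 2 * t \<in> diag_hooks" using * by (auto simp: hook_core_def)
        moreover have "nat (b - 2 * int t) = nat b - 2 * t" using 1 by auto
        ultimately show ?thesis using i2 1 by simp
      next
        case 2
        then have "nat b \<in> diag_hooks" "nat b < 2 * t" using b i1 by auto
        then have "2 * t - nat b \<notin> diag_hooks" using * by (auto simp: hook_core_def)
        moreover have "nat (- (b - 2 * int t)) = 2 * t - nat b" using 2 by auto
        ultimately show ?thesis using i2 2 by simp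
      next
        case 3
        then have "nat (- b) \<notin> diag_hooks" using b i1 by simp
        moreover have "nat (- (b - 2 * int t)) - 2 * t = nat (- b)"
          "2 * t < nat (- (b - 2 * int t))" using 3 by auto
        ultimately have "nat (- (b - 2 * int t)) \<notin> diag_hooks" using *
          by (metis hook_core_def)
        then show ?thesis using i2 3 by simp
      qed
    qed
  qed
  finally show ?thesis .
qed

lemma weight_eq: "weight l = \<Sum>diag_hooks"
  using card_diagram(2)[OF finite_diag_hooks odd_diag_hooks]
  by (simp add: diagram_diag_hooks card_ferrers)

text \<open>A square of side \<open>Suc m\<close> fits iff its corner \<open>(m, m)\<close> is a
  box, and the threshold \<open>2 * 0 + 1\<close> in \<open>diag_hooks_ge_iff\<close> keeps every
  diagonal hook.\<close>

lemma durfee_eq: "durfee l = card diag_hooks"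
proof -
  have "{..<d} \<times> {..<d} \<subseteq> ferrers l \<longleftrightarrow> d \<le> card diag_hooks" for d
  proof (cases d)
    case (Suc m)
    have "{d \<in> diag_hooks. 2 * 0 + 1 \<le> d} = diag_hooks"
      using odd_diag_hooks by (auto simp: Suc_le_eq intro: odd_pos)
    then have "m < card diag_hooks \<longleftrightarrow> (m, m) \<in> ferrers l"
      using diag_hooks_ge_iff[of m 0] by (simp add: mem_ferrers_iff)
    also have "\<dots> \<longleftrightarrow> {..<d} \<times> {..<d} \<subseteq> ferrers l"
    proof
      assume m: "(m, m) \<in> ferrers l"
      have "(i, j) \<in> ferrers l" if "i < d" "j < d" for i j
        using that m Suc row_len_antimono[OF part, of i m] by (simp add: mem_ferrers_iff)
      then show "{..<d} \<times> {..<d} \<subseteq> ferrers l" by auto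
    qed (auto simp: Suc)
    finally show ?thesis using Suc by auto
  qed simp
  then have "{d. {..<d} \<times> {..<d} \<subseteq> ferrers l} = {..card diag_hooks}" by auto
  then show ?thesis unfolding durfee_def by (simp add: Max_eq_iff)
qed

end

definition core_sets :: "nat \<Rightarrow> nat set set" where
  "core_sets t = {D. finite D \<and> (\<forall>d\<in>D. odd d) \<and> hook_core t D}"

text \<open>\<open>diagram\<close> provides the inverse: it rebuilds the shape from the hooks, and
  \<open>diagram_inj\<close> shows that the rebuilt partition has the prescribed hooks.\<close>

lemma bij_betw_diag_hooks:
  assumes t: "t > 0"
  shows "bij_betw self_conj_partition.diag_hooks (SC t) (core_sets t)"
proof -
  let ?h = self_conj_partition.diag_hooks
  have scp: "self_conj_partition l" if "l \<in> SC t" for l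
    using that by unfold_locales (auto simp: SC_def is_core_def)
  have "inj_on ?h (SC t)"
  proof
    fix l m assume lm: "l \<in> SC t" "m \<in> SC t" and eq: "?h l = ?h m"
    have "ferrers l = ferrers m"
      using self_conj_partition.diagram_diag_hooks[OF scp[OF lm(1)]]
        self_conj_partition.diagram_diag_hooks[OF scp[OF lm(2)]] eq by simp
    then show "l = m" using lm by (intro partition_eqI) (auto simp: SC_def is_core_def)
  qed
  moreover have "?h l \<in> core_sets t" if "l \<in> SC t" for l
  proof -
    interpret self_conj_partition l using that by (rule scp)
    show ?thesis
      using that finite_diag_hooks odd_diag_hooks is_core_iff[OF t] by (simp add: core_sets_def SC_def)
  qed
  moreover have "D \<in> ?h ` SC t" if "D \<in> core_sets t" for D
  proof -
    have D: "finite D" "\<And>d. d \<in> D \<Longrightarrow> odd d" "hook_core t D"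
      using that by (auto simp: core_sets_def)
    obtain l where l: "is_partition l" "ferrers l = diagram D"
      using partition_of_diagram[of "diagram D"] card_diagram(1)[OF D(1,2)] diagram_down[OF D(1,2)] by blast
    have sc: "self_conjugate l"
      unfolding self_conjugate_iff[OF l(1)] l(2) using diagram_sym by blast
    interpret self_conj_partition l by unfold_locales (fact l sc)+
    have "diag_hooks = D"
      using diagram_diag_hooks l(2) D by (intro diagram_inj finite_diag_hooks) (auto dest: odd_diag_hooks)
    moreover from this have "l \<in> SC t"
      using is_core_iff[OF t] D(3) sc by (simp add: SC_def)
    ultimately show ?thesis by blast
  qed
  ultimately show ?thesis by (auto simp: bij_betw_def)
qed

section \<open>The Jacobi triple product modulo powers of X\<close>

definition eqmod :: "nat \<Rightarrow> 'a :: field fps \<Rightarrow> 'a fps \<Rightarrow> bool" where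
  "eqmod n f g \<longleftrightarrow> fps_X ^ n dvd f - g"

lemma fps_X_power_dvd_iff: "fps_X ^ n dvd (f :: 'a :: field fps) \<longleftrightarrow> (\<forall>k<n. fps_nth f k = 0)"
proof
  assume "fps_X ^ n dvd f"
  then show "\<forall>k<n. fps_nth f k = 0" by (auto simp: fps_X_power_mult_nth elim!: dvdE)
next
  assume *: "\<forall>k<n. fps_nth f k = 0"
  then have "f = 0 \<or> subdegree f \<ge> n"
    by (metis subdegree_geI)
  then have "f = fps_X ^ n * fps_shift n f" by (rule fps_conv_fps_X_power_mult_fps_shift)
  then show "fps_X ^ n dvd f" by (metis dvd_triv_left)
qed

lemma eqmod_nth_iff: "eqmod n f g \<longleftrightarrow> (\<forall>k<n. fps_nth f k = fps_nth g k)"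
  by (auto simp: eqmod_def fps_X_power_dvd_iff)

lemma eqmod_refl [simp]: "eqmod n f f"
  by (simp add: eqmod_nth_iff)

lemma eqmod_sym: "eqmod n f g \<Longrightarrow> eqmod n g f"
  by (simp add: eqmod_nth_iff)

lemma eqmod_trans [trans]: "eqmod n f g \<Longrightarrow> eqmod n g h \<Longrightarrow> eqmod n f h"
  by (simp add: eqmod_nth_iff)

lemma eqmod_mult: "eqmod n f g \<Longrightarrow> eqmod n f' g' \<Longrightarrow> eqmod n (f * f') (g * g')"
proof -
  assume "eqmod n f g" "eqmod n f' g'"
  then have "fps_X ^ n dvd (f - g) * f' + g * (f' - g')"
    unfolding eqmod_def by (intro dvd_add dvd_mult dvd_mult2)
  then show ?thesis by (simp add: eqmod_def algebra_simps)
qed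

lemma eqmod_sum: "(\<And>x. x \<in> A \<Longrightarrow> eqmod n (f x) (g x)) \<Longrightarrow> eqmod n (sum f A) (sum g A)"
  by (simp add: eqmod_nth_iff fps_sum_nth)

lemma eqmod_mult_inverse:
  assumes "fps_nth g 0 \<noteq> 0" "eqmod n f g"
  shows "eqmod n (f * inverse g) 1"
proof -
  have "eqmod n (f * inverse g) (g * inverse g)"
    using assms(2) by (rule eqmod_mult) simp
  then show ?thesis using assms(1) by (simp add: inverse_mult_eq_1')
qed

lemma fps_X_power_dvd_power:
  assumes "fps_nth (Q :: 'a :: field fps) 0 = 0" "n \<le> m"
  shows "fps_X ^ n dvd Q ^ m"
proof -
  have "fps_X dvd Q" using fps_X_power_dvd_iff[of 1 Q] assms(1) by simp
  then have "fps_X ^ m dvd Q ^ m" by (rule dvd_power_same)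
  then show ?thesis using assms(2) by (meson dvd_trans le_imp_power_dvd)
qed

section \<open>The q-Pochhammer symbol (Q; Q)_n and Gaussian binomial coefficients\<close>

definition qfac :: "'a :: field fps \<Rightarrow> nat \<Rightarrow> 'a fps" where
  "qfac Q n = (\<Prod>k=1..n. 1 - Q ^ k)"

lemma qfac_0 [simp]: "qfac Q 0 = 1"
  by (simp add: qfac_def)

lemma qfac_Suc [simp]: "qfac Q (Suc n) = qfac Q n * (1 - Q ^ Suc n)"
  by (simp add: qfac_def)

lemma qfac_nth_0 [simp]: "fps_nth Q 0 = 0 \<Longrightarrow> fps_nth (qfac Q n) 0 = 1"
  by (induction n) auto

lemma eqmod_qfac:
  assumes "fps_nth Q 0 = 0" "l \<le> m"
  shows "eqmod l (qfac Q m) (qfac Q l)"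
  using assms(2)
proof (induction m rule: dec_induct)
  case (step m)
  have "eqmod l (1 - Q ^ Suc m) 1"
    using fps_X_power_dvd_power[OF assms(1), of l "Suc m"] step.hyps
    by (simp add: eqmod_def)
  from eqmod_mult[OF step.IH this] show ?case by simp
qed simp

text \<open>The Gaussian binomial coefficient. When \<open>Q\<close> has constant term 0, every
  \<open>qfac\<close> has constant term 1, so \<open>inverse\<close> is a true inverse.\<close>

definition gauss :: "'a :: field fps \<Rightarrow> nat \<Rightarrow> nat \<Rightarrow> 'a fps" where
  "gauss Q n k = (if k \<le> n then qfac Q n * inverse (qfac Q k * qfac Q (n - k)) else 0)"

lemma gauss_0 [simp]: "fps_nth Q 0 = 0 \<Longrightarrow> gauss Q n 0 = 1"
  by (simp add: gauss_def inverse_mult_eq_1')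

lemma gauss_self [simp]: "fps_nth Q 0 = 0 \<Longrightarrow> gauss Q n n = 1"
  by (simp add: gauss_def inverse_mult_eq_1')

lemma gauss_sym: "k \<le> n \<Longrightarrow> gauss Q n (n - k) = gauss Q n k"
  by (simp add: gauss_def mult.commute)

lemma gauss_qfac:
  assumes "fps_nth Q 0 = 0" "k \<le> n"
  shows "gauss Q n k * (qfac Q k * qfac Q (n - k)) = qfac Q n"
  using assms by (simp add: gauss_def mult.assoc inverse_mult_eq_1)

text \<open>Over the common denominator this becomes (1 - Q^a) + Q^a (1 - Q^b) = 1 - Q^(a+b) with a
  = \<open>n - k\<close> and b = \<open>Suc k\<close>.\<close>

lemma gauss_pascal:
  assumes Q: "fps_nth Q 0 = 0" and k: "k \<le> n"
  shows "gauss Q (Suc n) (Suc k) = gauss Q n (Suc k) + Q ^ (n - k) * gauss Q n k"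
proof (cases "k = n")
  case True
  have "gauss Q n (Suc n) = 0" by (simp add: gauss_def)
  then show ?thesis using Q True by (simp del: qfac_Suc)
next
  case False
  with k obtain m where n: "n = Suc (k + m)"
    by (metis add_Suc_right le_neq_implies_less less_imp_Suc_add)
  let ?u = "qfac Q (Suc k) * qfac Q (Suc m)"
  have "fps_nth ?u 0 = 1" using Q by (simp del: qfac_Suc)
  then have "?u \<noteq> 0" by (auto simp del: qfac_Suc)
  moreover have "gauss Q (Suc n) (Suc k) * ?u = (gauss Q n (Suc k) + Q ^ (n - k) * gauss Q n k) * ?u"
  proof -
    have 1: "gauss Q (Suc n) (Suc k) * ?u = qfac Q (Suc n)"
      using gauss_qfac[OF Q, of "Suc k" "Suc n"] n by (simp del: qfac_Suc)
    have 2: "gauss Q n (Suc k) * ?u = qfac Q n * (1 - Q ^ Suc m)"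
    proof -
      have "gauss Q n (Suc k) * (qfac Q (Suc k) * qfac Q m) = qfac Q n"
        using gauss_qfac[OF Q, of "Suc k" n] n by (simp del: qfac_Suc)
      then show ?thesis unfolding qfac_Suc[of _ m] by (simp only: mult.assoc[symmetric])
    qed
    have 3: "gauss Q n k * ?u = qfac Q n * (1 - Q ^ Suc k)"
    proof -
      have "gauss Q n k * (qfac Q k * qfac Q (Suc m)) = qfac Q n"
        using gauss_qfac[OF Q, of k n] n by (simp del: qfac_Suc)
      from this[symmetric] show ?thesis unfolding qfac_Suc[of _ k] by (simp only: mult_ac)
    qed
    have "(gauss Q n (Suc k) + Q ^ (n - k) * gauss Q n k) * ?u
        = qfac Q n * (1 - Q ^ Suc m) + Q ^ Suc m * (qfac Q n * (1 - Q ^ Suc k))"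
      using 2 3 n by (simp add: distrib_right mult.assoc del: qfac_Suc power_Suc)
    also have "\<dots> = qfac Q n * (1 - Q ^ (Suc m + Suc k))"
      unfolding power_add by (simp add: algebra_simps del: power_Suc)
    also have "\<dots> = qfac Q (Suc n)" using n by (simp add: add_ac)
    finally show ?thesis using 1 by simp
  qed
  ultimately show ?thesis by (metis mult_right_cancel)
qed

text \<open>The triangular number c (c + 1) / 2, which stays nonnegative for negative c;
  \<open>tri (- c)\<close> is c (c - 1) / 2.\<close>

definition tri :: "int \<Rightarrow> nat" where
  "tri c = nat (c * (c + 1) div 2)"

lemma int_tri: "2 * int (tri c) = c * (c + 1)"
proof -
  have "c * (c + 1) \<ge> 0"
    by (cases "c \<ge> 0") (auto simp: mult_nonpos_nonpos)
  moreover have "even (c * (c + 1))" by simp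
  ultimately show ?thesis by (auto simp: tri_def)
qed

text \<open>With \<open>A = z * q\<close> and \<open>B = q / z\<close> this is the familiar term \<open>(- z)\<^sup>c * q\<close> to the power \<open>c * c\<close>;
  the exponents of \<open>A\<close> and \<open>B\<close> are never negative, so no Laurent series are needed.\<close>
definition jterm :: "'a :: field fps \<Rightarrow> 'a fps \<Rightarrow> int \<Rightarrow> 'a fps" where
  "jterm A B c = (-1) ^ nat \<bar>c\<bar> * A ^ tri c * B ^ tri (- c)"

lemma jterm_0 [simp]: "jterm A B 0 = 1"
  by (simp add: jterm_def tri_def)

lemma jterm_swap: "jterm A B (- c) = jterm B A c"
  by (simp add: jterm_def mult_ac)

lemma minus_one_power_nat_abs_Suc: "(-1) ^ nat \<bar>c + 1\<bar> = - ((-1) ^ nat \<bar>c\<bar> :: 'a :: ring_1)"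
proof (cases "c \<ge> 0")
  case True
  then have *: "nat \<bar>c + 1\<bar> = Suc (nat \<bar>c\<bar>)" by auto
  show ?thesis unfolding * by simp
next
  case False
  then have *: "nat \<bar>c\<bar> = Suc (nat \<bar>c + 1\<bar>)" by auto
  show ?thesis unfolding * by simp
qed

text \<open>Formally, consecutive terms have quotient - A (A B)^c. The factor
  \<open>(A * B) ^ nat (int a - c)\<close> avoids the negative power that would arise for c <
  0.\<close>

lemma jterm_step:
  assumes "c \<le> int a"
  shows "jterm A B (c + 1) * (A * B) ^ nat (int a - c) = - jterm A B c * (A * (A * B) ^ a)"
proof -
  define m where "m = nat (int a - c)"
  have m: "int m = int a - c" using assms by (simp add: m_def)
  have "2 * int (tri (c + 1) + m) = 2 * int (tri c + 1 + a)"
    unfolding of_nat_add distrib_left int_tri using m by (simp add: algebra_simps)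
  then have 1: "tri (c + 1) + m = tri c + 1 + a" by presburger
  have "2 * int (tri (- (c + 1)) + m) = 2 * int (tri (- c) + a)"
    unfolding of_nat_add distrib_left int_tri using m by (simp add: algebra_simps)
  then have 2: "tri (- (c + 1)) + m = tri (- c) + a" by presburger
  have "jterm A B (c + 1) * (A * B) ^ m
     = (-1) ^ nat \<bar>c + 1\<bar> * (A ^ (tri (c + 1) + m) * B ^ (tri (- (c + 1)) + m))"
    by (simp add: jterm_def power_add power_mult_distrib mult_ac)
  also have "\<dots> = - ((-1) ^ nat \<bar>c\<bar> * (A ^ (tri c + 1 + a) * B ^ (tri (- c) + a)))"
    unfolding 1 2 minus_one_power_nat_abs_Suc by simp
  also have "\<dots> = - jterm A B c * (A * (A * B) ^ a)"
    by (simp add: jterm_def power_add power_mult_distrib mult_ac)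
  finally show ?thesis by (simp add: m_def)
qed

text \<open>The sum side of the finite triple product, a form of the q-binomial theorem; the index
  \<open>j - b\<close> runs from \<open>-b\<close> to \<open>a\<close>. Independent bounds permit an
  induction on each.\<close>

definition jsum :: "'a :: field fps \<Rightarrow> 'a fps \<Rightarrow> nat \<Rightarrow> nat \<Rightarrow> 'a fps" where
  "jsum A B a b = (\<Sum>j\<le>a + b. jterm A B (int j - int b) * gauss (A * B) (a + b) j)"

text \<open>The Pascal rule splits the sum in two. The first part is the old sum; in the second,
  \<open>jterm_step\<close> turns the power of \<open>A * B\<close>, which depends on
  \<open>j\<close>, into the fixed factor \<open>- A * (A * B) ^ a\<close>.\<close>

lemma jsum_Suc:
  assumes Q: "fps_nth (A * B) 0 = 0"
  shows "jsum A B (Suc a) b = jsum A B a b * (1 - A * (A * B) ^ a)"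
proof -
  let ?N = "a + b" and ?Q = "A * B"
  let ?w = "\<lambda>j. jterm A B (int j - int b)"
  have gt: "gauss ?Q ?N (Suc ?N) = 0" by (simp add: gauss_def)
  have "jsum A B (Suc a) b = (\<Sum>j\<le>Suc ?N. ?w j * gauss ?Q (Suc ?N) j)"
    by (simp add: jsum_def)
  also have "\<dots> = ?w 0 + (\<Sum>j\<le>?N. ?w (Suc j) * gauss ?Q (Suc ?N) (Suc j))"
    by (subst sum.atMost_Suc_shift) (use Q in simp)
  also have "(\<Sum>j\<le>?N. ?w (Suc j) * gauss ?Q (Suc ?N) (Suc j))
      = (\<Sum>j\<le>?N. ?w (Suc j) * gauss ?Q ?N (Suc j)) + (\<Sum>j\<le>?N. ?w (Suc j) * ?Q ^ (?N - j) * gauss ?Q ?N j)"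
    using gauss_pascal[OF Q] by (simp add: algebra_simps flip: sum.distrib)
  \<comment> \<open>The isolated \<open>?w 0\<close> is the summand at \<open>j = 0\<close>, as the
    Gaussian coefficient is 1 there; the new top summand vanishes.\<close>
  also have "?w 0 + (\<dots>) = (\<Sum>j\<le>Suc ?N. ?w j * gauss ?Q ?N j)
      + (\<Sum>j\<le>?N. ?w (Suc j) * ?Q ^ (?N - j) * gauss ?Q ?N j)"
    by (simp only: sum.atMost_Suc_shift gauss_0[OF Q] add.assoc mult_1_right)
  also have "(\<Sum>j\<le>Suc ?N. ?w j * gauss ?Q ?N j) = jsum A B a b"
    using gt by (simp add: jsum_def)
  also have "(\<Sum>j\<le>?N. ?w (Suc j) * ?Q ^ (?N - j) * gauss ?Q ?N j)
      = (\<Sum>j\<le>?N. - (?w j * gauss ?Q ?N j) * (A * ?Q ^ a))"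
  proof (intro sum.cong refl)
    fix j assume "j \<in> {..?N}"
    then have "int j - int b \<le> int a" "nat (int a - (int j - int b)) = ?N - j" by auto
    from jterm_step[OF this(1), of A B] this(2)
    have "?w (Suc j) * ?Q ^ (?N - j) = - ?w j * (A * ?Q ^ a)" by (simp add: algebra_simps)
    then show "?w (Suc j) * ?Q ^ (?N - j) * gauss ?Q ?N j = - (?w j * gauss ?Q ?N j) * (A * ?Q ^ a)"
      by simp
  qed
  also have "\<dots> = - jsum A B a b * (A * ?Q ^ a)"
    by (simp add: jsum_def sum_distrib_right sum_negf)
  finally show ?thesis by (simp add: algebra_simps)
qed

text \<open>Reversal of the sum negates the index of \<open>jterm\<close>. This lets
  \<open>jsum_Suc\<close> also produce the factors belonging to \<open>B\<close>.\<close>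

lemma jsum_swap: "jsum A B a b = jsum B A b a"
proof -
  have "jsum A B a b = (\<Sum>j\<le>a + b. jterm A B (int (a + b - j) - int b) * gauss (A * B) (a + b) (a + b - j))"
    unfolding jsum_def by (rule sum.nat_diff_reindex[symmetric, of _ "Suc (a + b)", simplified lessThan_Suc_atMost, simplified])
  also have "\<dots> = jsum B A b a"
    unfolding jsum_def
  proof (intro sum.cong)
    fix j assume "j \<in> {..b + a}"
    then have j: "j \<le> a + b" by simp
    then have "int (a + b - j) - int b = - (int j - int a)" by auto
    then show "jterm A B (int (a + b - j) - int b) * gauss (A * B) (a + b) (a + b - j)
       = jterm B A (int j - int a) * gauss (B * A) (b + a) j"
      using gauss_sym[OF j, of "A * B"] by (simp only: jterm_swap) (simp add: mult.commute add.commute)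
  qed (simp add: add.commute)
  finally show ?thesis .
qed

lemma finite_jacobi_triple_product:
  assumes Q: "fps_nth (A * B) 0 = 0"
  shows "jsum A B a b = (\<Prod>k<a. 1 - A * (A * B) ^ k) * (\<Prod>k<b. 1 - B * (A * B) ^ k)"
proof (induction a)
  case 0
  have Q': "fps_nth (B * A) 0 = 0" using Q by (simp add: mult.commute)
  have "jsum B A b 0 = (\<Prod>k<b. 1 - B * (B * A) ^ k)"
  proof (induction b)
    case 0
    show ?case using Q' by (simp add: jsum_def)
  next
    case (Suc b)
    then show ?case by (simp add: jsum_Suc[OF Q'])
  qed
  then show ?case by (simp add: jsum_swap[of A B] mult.commute[of A B])
next
  case (Suc a)
  then show ?case by (simp add: jsum_Suc[OF Q] mult_ac)
qed

text \<open>The right side is \<open>c * c\<close>. The bound controls the order of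
  \<open>jterm A B c\<close> and, later, how many \<open>c\<close> have small weight.\<close>

lemma abs_le_tri: "nat \<bar>c\<bar> \<le> tri c + tri (- c)"
proof -
  have "2 * int (tri c + tri (- c)) = 2 * (c * c)"
    unfolding of_nat_add distrib_left int_tri by (simp add: algebra_simps)
  moreover have "\<bar>c\<bar> \<le> c * c"
    using mult_le_mono1[of 1 "nat \<bar>c\<bar>" "nat \<bar>c\<bar>"] by (cases "c = 0") (auto simp: abs_mult_self_eq nat_mult_distrib[symmetric] nat_le_iff)
  ultimately have "2 * int (nat \<bar>c\<bar>) \<le> 2 * int (tri c + tri (- c))" by simp
  then show ?thesis by presburger
qed

text \<open>In the exact identity with \<open>a = b = n\<close>, multiplied by
  \<open>qfac (A * B) n\<close>, the coefficient of the term with index c is 1 modulo X^(n - |c|),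
  since every \<open>qfac\<close> in it has index at least n - |c|. The term itself is divisible by
  X^|c|, which makes up the difference.\<close>

lemma jacobi_triple_product_mod:
  assumes A: "fps_nth A 0 = 0" and B: "fps_nth B 0 = 0"
  shows "eqmod n (qfac (A * B) n * (\<Prod>k<n. (1 - A * (A * B) ^ k) * (1 - B * (A * B) ^ k)))
           (\<Sum>j\<le>2 * n. jterm A B (int j - int n))"
proof -
  let ?Q = "A * B"
  have Q: "fps_nth ?Q 0 = 0" using A by simp
  have "eqmod n (jterm A B (int j - int n) * (qfac ?Q n * gauss ?Q (2 * n) j)) (jterm A B (int j - int n))"
    if j: "j \<le> 2 * n" for j
  proof -
    define c where "c = int j - int n"
    define l where "l = n - nat \<bar>c\<bar>"
    have l: "l \<le> n" "l \<le> 2 * n" "l \<le> j" "l \<le> 2 * n - j" "n \<le> l + nat \<bar>c\<bar>"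
      using j by (auto simp: l_def c_def)
    note e = eqmod_qfac[OF Q]
    have "eqmod l (qfac ?Q n * qfac ?Q (2 * n)) (qfac ?Q l * qfac ?Q l)"
      by (intro eqmod_mult e l)
    also have "eqmod l (qfac ?Q l * qfac ?Q l) (qfac ?Q j * qfac ?Q (2 * n - j))"
      by (rule eqmod_sym) (intro eqmod_mult e l)
    finally have "eqmod l (qfac ?Q n * qfac ?Q (2 * n) * inverse (qfac ?Q j * qfac ?Q (2 * n - j))) 1"
      by (intro eqmod_mult_inverse) (use Q in auto)
    then have "fps_X ^ l dvd qfac ?Q n * gauss ?Q (2 * n) j - 1"
      using j by (simp add: eqmod_def gauss_def mult.assoc)
    moreover have "fps_X ^ nat \<bar>c\<bar> dvd jterm A B c"
    proof -
      have "fps_X ^ (tri c + tri (- c)) dvd A ^ tri c * B ^ tri (- c)"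
        unfolding power_add by (intro mult_dvd_mono fps_X_power_dvd_power A B order_refl)
      then have "fps_X ^ nat \<bar>c\<bar> dvd A ^ tri c * B ^ tri (- c)"
        using abs_le_tri[of c] by (meson dvd_trans le_imp_power_dvd)
      then show ?thesis unfolding jterm_def mult.assoc by (rule dvd_mult)
    qed
    ultimately have "fps_X ^ (l + nat \<bar>c\<bar>) dvd (qfac ?Q n * gauss ?Q (2 * n) j - 1) * jterm A B c"
      unfolding power_add by (rule mult_dvd_mono)
    then have "fps_X ^ n dvd (qfac ?Q n * gauss ?Q (2 * n) j - 1) * jterm A B c"
      using l(5) by (meson dvd_trans le_imp_power_dvd)
    then show ?thesis by (simp add: eqmod_def c_def algebra_simps)
  qed
  then have "eqmod n (\<Sum>j\<le>2 * n. jterm A B (int j - int n) * (qfac ?Q n * gauss ?Q (2 * n) j))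
       (\<Sum>j\<le>2 * n. jterm A B (int j - int n))"
    by (intro eqmod_sum) auto
  also have "(\<Sum>j\<le>2 * n. jterm A B (int j - int n) * (qfac ?Q n * gauss ?Q (2 * n) j))
      = qfac ?Q n * jsum A B n n"
    unfolding mult_2 by (simp add: jsum_def sum_distrib_left mult_ac)
  also have "jsum A B n n = (\<Prod>k<n. (1 - A * ?Q ^ k) * (1 - B * ?Q ^ k))"
    by (simp add: finite_jacobi_triple_product[OF Q] prod.distrib)
  finally show ?thesis .
qed

section \<open>Euler's product over odd exponents\<close>

lemma qfac_double: "qfac Y (2 * n) = (\<Prod>k<n. 1 - Y ^ (2 * k + 1)) * qfac (Y ^ 2) n"
proof (induction n)
  case (Suc n)
  have "(Y ^ 2) ^ Suc n = Y ^ (2 * n + 2)" unfolding power_mult[symmetric] by simp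
  then have "qfac (Y ^ 2) (Suc n) = qfac (Y ^ 2) n * (1 - Y ^ (2 * n + 2))" by (simp only: qfac_Suc)
  moreover have "qfac Y (2 * Suc n) = qfac Y (2 * n) * (1 - Y ^ (2 * n + 1)) * (1 - Y ^ (2 * n + 2))"
    by simp
  ultimately show ?case using Suc.IH by (simp add: mult_ac del: qfac_Suc power_Suc)
qed simp

text \<open>Cancelling the even factors of \<open>qfac Y (2 * N)\<close> leaves the odd ones
  exactly; only then is everything cut down to \<open>n\<close> factors. \<open>N\<close> is kept
  free because the residue classes together supply \<open>n * t\<close> odd factors.\<close>

lemma euler_odd_product_mod:
  assumes Y: "fps_nth Y 0 = 0" and N: "n \<le> N"
  shows "eqmod n (\<Prod>k<N. 1 - Y ^ (2 * k + 1)) (qfac Y n * inverse (qfac (Y ^ 2) n))"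
proof -
  have Y2: "fps_nth (Y ^ 2) 0 = 0" using Y by (simp add: power2_eq_square)
  have "(\<Prod>k<N. 1 - Y ^ (2 * k + 1)) = qfac Y (2 * N) * inverse (qfac (Y ^ 2) N)"
    unfolding qfac_double using Y2 by (simp add: mult.assoc inverse_mult_eq_1')
  moreover have "eqmod n (qfac Y (2 * N)) (qfac Y n)"
    using N by (intro eqmod_qfac Y) simp
  moreover have "eqmod n (inverse (qfac (Y ^ 2) N)) (inverse (qfac (Y ^ 2) n))"
  proof -
    have "eqmod n (qfac (Y ^ 2) n * inverse (qfac (Y ^ 2) N)) 1"
      by (intro eqmod_mult_inverse eqmod_sym[OF eqmod_qfac] Y2 N) (use Y2 in simp)
    from eqmod_mult[OF eqmod_refl[of n "inverse (qfac (Y ^ 2) n)"] this]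
    show ?thesis using Y2 by (simp add: inverse_mult_eq_1 flip: mult.assoc)
  qed
  ultimately show ?thesis by (simp add: eqmod_mult)
qed

section \<open>Generating functions\<close>

text \<open>A sum over an infinite fibre would be 0 by default, so multiplicativity needs finite
  fibres.\<close>

definition gfun :: "'a set \<Rightarrow> ('a \<Rightarrow> nat) \<Rightarrow> ('a \<Rightarrow> 'b :: comm_semiring_1) \<Rightarrow> 'b fps" where
  "gfun A w s = Abs_fps (\<lambda>n. \<Sum>a | a \<in> A \<and> w a = n. s a)"

lemma gfun_nth: "fps_nth (gfun A w s) n = (\<Sum>a | a \<in> A \<and> w a = n. s a)"
  by (simp add: gfun_def)

lemma gfun_bij_betw:
  assumes bij: "bij_betw f A B" and w: "\<And>a. a \<in> A \<Longrightarrow> w' (f a) = w a"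
    and s: "\<And>a. a \<in> A \<Longrightarrow> s' (f a) = s a"
  shows "gfun A w s = gfun B w' s'"
proof (rule fps_ext)
  fix n
  have "bij_betw f {a \<in> A. w a = n} {b \<in> B. w' b = n}"
    using bij w by (auto simp: bij_betw_def inj_on_def)
  from sum.reindex_bij_betw[OF this, of s']
  show "fps_nth (gfun A w s) n = fps_nth (gfun B w' s') n"
    using s by (simp add: gfun_nth)
qed

lemma gfun_times:
  assumes A: "\<And>n. finite {a \<in> A. w a = n}" and B: "\<And>n. finite {b \<in> B. w' b = n}"
  shows "gfun (A \<times> B) (\<lambda>(a, b). w a + w' b) (\<lambda>(a, b). s a * s' b) = gfun A w s * gfun B w' s'"
proof (rule fps_ext)
  fix n
  let ?S = "{p. p \<in> A \<times> B \<and> (case p of (a, b) \<Rightarrow> w a + w' b) = n}"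
  let ?h = "\<lambda>(a, b). s a * s' b"
  have fiber: "{p \<in> ?S. w (fst p) = i} = {a \<in> A. w a = i} \<times> {b \<in> B. w' b = n - i}" if "i \<le> n" for i
    using that by auto
  have "?S \<subseteq> (\<Union>i\<in>{0..n}. {a \<in> A. w a = i} \<times> {b \<in> B. w' b = n - i})" by auto
  moreover have "finite \<dots>" using A B by blast
  ultimately have fin: "finite ?S" by (rule finite_subset)
  have "fps_nth (gfun A w s * gfun B w' s') n
      = (\<Sum>i=0..n. (\<Sum>a | a \<in> A \<and> w a = i. s a) * (\<Sum>b | b \<in> B \<and> w' b = n - i. s' b))"
    by (simp add: fps_mult_nth gfun_nth)
  also have "\<dots> = (\<Sum>i=0..n. \<Sum>p\<in>{p \<in> ?S. w (fst p) = i}. ?h p)"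
  proof (intro sum.cong refl)
    fix i assume "i \<in> {0..n}"
    then have "i \<le> n" by simp
    then show "(\<Sum>a | a \<in> A \<and> w a = i. s a) * (\<Sum>b | b \<in> B \<and> w' b = n - i. s' b)
        = (\<Sum>p\<in>{p \<in> ?S. w (fst p) = i}. ?h p)"
      unfolding fiber[OF \<open>i \<le> n\<close>] by (simp add: sum_product sum.cartesian_product)
  qed
  also have "\<dots> = (\<Sum>p\<in>?S. ?h p)"
    by (rule sum.group[OF fin]) auto
  finally show "fps_nth (gfun (A \<times> B) (\<lambda>(a, b). w a + w' b) ?h) n = fps_nth (gfun A w s * gfun B w' s') n"
    by (simp add: gfun_nth)
qed

text \<open>A label of the pair of residue classes of \<open>d\<close> and \<open>- d\<close> modulo \<open>2 * t\<close>.\<close>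
definition fold_residue :: "nat \<Rightarrow> nat \<Rightarrow> nat" where
  "fold_residue t d = min (d mod (2 * t)) (2 * t - d mod (2 * t))"

lemma fold_residue_diff: "2 * t < d \<Longrightarrow> fold_residue t (d - 2 * t) = fold_residue t d"
  by (simp add: fold_residue_def le_mod_geq)

lemma fold_residue_reflect: "0 < d \<Longrightarrow> d < 2 * t \<Longrightarrow> fold_residue t (2 * t - d) = fold_residue t d"
  by (auto simp: fold_residue_def)

definition cores :: "nat \<Rightarrow> nat set \<Rightarrow> nat set set" where
  "cores t R = {D \<in> core_sets t. \<forall>d\<in>D. fold_residue t d \<in> R}"

lemma core_setsD:
  assumes "D \<in> core_sets t" "d \<in> D"
  shows "odd d" "0 < d" "2 * t < d \<Longrightarrow> d - 2 * t \<in> D" "d < 2 * t \<Longrightarrow> 2 * t - d \<notin> D"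
  using assms by (auto simp: core_sets_def hook_core_def intro: odd_pos)

lemma finite_core_set: "D \<in> core_sets t \<Longrightarrow> finite D"
  by (simp add: core_sets_def)

lemma finite_cores_weight: "finite {D \<in> cores t R. \<Sum>D = n}"
proof (rule finite_subset)
  show "{D \<in> cores t R. \<Sum>D = n} \<subseteq> Pow {..n}"
    by (auto simp: cores_def dest!: finite_core_set intro: member_le_sum[of _ _ "\<lambda>x. x", simplified])
qed simp

lemma core_set_descent:
  assumes D: "D \<in> core_sets t" and d: "a + 2 * t * k \<in> D" "i \<le> k" and a: "0 < a"
  shows "a + 2 * t * i \<in> D"
  using d
proof (induction k)
  case (Suc k)
  show ?case
  proof (cases "i = Suc k")
    case False
    have "a + 2 * t * Suc k - 2 * t \<in> D"
      using core_setsD(3)[OF D Suc.prems(1)] a by simp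
    then show ?thesis using Suc False by simp
  qed (use Suc.prems in simp)
qed simp

lemma core_set_mod:
  assumes D: "D \<in> core_sets t" and d: "d \<in> D"
  shows "d mod (2 * t) \<in> D"
proof -
  have "odd (d mod (2 * t))"
    using core_setsD(1)[OF D d] by (simp add: dvd_mod_iff)
  then show ?thesis
    using core_set_descent[OF D, of "d mod (2 * t)" "d div (2 * t)" 0] d odd_pos by simp
qed

lemma cores_all:
  assumes t: "t > 0"
  shows "cores t {r. odd r \<and> r < t} = core_sets t"
proof -
  have "odd (fold_residue t d) \<and> fold_residue t d < t" if D: "D \<in> core_sets t" and d: "d \<in> D" for D d
  proof -
    define x where "x = d mod (2 * t)"
    have x: "x \<in> D" "x < 2 * t" "odd x"
      using core_set_mod[OF D d] t core_setsD(1)[OF D] by (auto simp: x_def)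
    \<comment> \<open>\<open>t\<close> equals its own reflection \<open>2 * t - t\<close>, which
      \<open>hook_core\<close> forbids.\<close>
    have "x \<noteq> t" using core_setsD(4)[OF D x(1,2)] x(1) by auto
    then show ?thesis using x(2,3) by (auto simp: fold_residue_def x_def[symmetric] min_def)
  qed
  then show ?thesis by (auto simp: cores_def)
qed

lemma cores_empty: "cores t {} = {{}}"
  by (auto simp: cores_def core_sets_def hook_core_def)

lemma core_sets_filter:
  assumes "D \<in> core_sets t"
  shows "{d \<in> D. fold_residue t d \<in> R} \<in> core_sets t"
  using assms core_setsD[OF assms] by (auto simp: core_sets_def hook_core_def fold_residue_diff)

text \<open>Subtraction of \<open>2 * t\<close> and reflection in \<open>2 * t\<close> both preserve
  the residue label, so parts with different labels impose no condition on each other.\<close>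

lemma core_sets_Un:
  assumes D: "D \<in> core_sets t" "\<And>d. d \<in> D \<Longrightarrow> fold_residue t d \<in> R"
    and E: "E \<in> core_sets t" "\<And>d. d \<in> E \<Longrightarrow> fold_residue t d \<notin> R"
  shows "D \<union> E \<in> core_sets t"
proof -
  have "2 * t - d \<notin> E" if "d \<in> D" "d < 2 * t" for d
    using that D E fold_residue_reflect[of d t] core_setsD(2)[OF D(1)] by metis
  moreover have "2 * t - d \<notin> D" if "d \<in> E" "d < 2 * t" for d
    using that D E fold_residue_reflect[of d t] core_setsD(2)[OF E(1)] by metis
  ultimately show ?thesis
    using D(1) E(1) by (auto simp: core_sets_def hook_core_def)
qed

abbreviation core_gf :: "nat \<Rightarrow> nat set \<Rightarrow> rat fps" where
  "core_gf t R \<equiv> gfun (cores t R) (\<lambda>D. \<Sum>D) (\<lambda>D. (- 1) ^ card D)"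

lemma core_gf_insert:
  assumes r: "r \<notin> R"
  shows "core_gf t (insert r R) = core_gf t {r} * core_gf t R"
proof -
  have "bij_betw (\<lambda>(D, E). D \<union> E) (cores t {r} \<times> cores t R) (cores t (insert r R))"
  proof (rule bij_betw_byWitness[where f' = "\<lambda>D. ({d \<in> D. fold_residue t d \<in> {r}}, {d \<in> D. fold_residue t d \<in> R})"])
    show "\<forall>a\<in>cores t {r} \<times> cores t R.
       ({d \<in> case a of (D, E) \<Rightarrow> D \<union> E. fold_residue t d \<in> {r}}, {d \<in> case a of (D, E) \<Rightarrow> D \<union> E. fold_residue t d \<in> R}) = a"
      using r by (auto simp: cores_def)
    show "\<forall>a'\<in>cores t (insert r R). (case ({d \<in> a'. fold_residue t d \<in> {r}}, {d \<in> a'. fold_residue t d \<in> R}) of (D, E) \<Rightarrow> D \<union> E) = a'"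
      by (auto simp: cores_def)
    show "(\<lambda>(D, E). D \<union> E) ` (cores t {r} \<times> cores t R) \<subseteq> cores t (insert r R)"
    proof clarify
      fix D E assume "D \<in> cores t {r}" "E \<in> cores t R"
      then have "D \<union> E \<in> core_sets t"
        using r by (intro core_sets_Un[of D t "{r}"]) (auto simp: cores_def)
      then show "D \<union> E \<in> cores t (insert r R)"
        using \<open>D \<in> cores t {r}\<close> \<open>E \<in> cores t R\<close> by (auto simp: cores_def)
    qed
    show "(\<lambda>D. ({d \<in> D. fold_residue t d \<in> {r}}, {d \<in> D. fold_residue t d \<in> R})) ` cores t (insert r R) \<subseteq> cores t {r} \<times> cores t R"
      using core_sets_filter[of _ t "{r}"] core_sets_filter[of _ t R] by (auto simp: cores_def)
  qed
  then have "gfun (cores t {r} \<times> cores t R) (\<lambda>(D, E). \<Sum>D + \<Sum>E) (\<lambda>(D, E). (- 1) ^ card D * (- 1) ^ card E)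
      = core_gf t (insert r R)"
  proof (rule gfun_bij_betw)
    fix p assume "p \<in> cores t {r} \<times> cores t R"
    then obtain D E where p: "p = (D, E)" "D \<in> cores t {r}" "E \<in> cores t R" by auto
    then have fin: "finite D" "finite E" and disj: "D \<inter> E = {}"
      using r by (auto simp: cores_def finite_core_set)
    show "\<Sum>(case p of (D, E) \<Rightarrow> D \<union> E) = (case p of (D, E) \<Rightarrow> \<Sum>D + \<Sum>E)"
      using sum.union_disjoint[OF fin disj, of "\<lambda>x. x"] p(1) by simp
    show "(- 1) ^ card (case p of (D, E) \<Rightarrow> D \<union> E) = (case p of (D, E) \<Rightarrow> (- 1 :: rat) ^ card D * (- 1) ^ card E)"
      using card_Un_disjoint[OF fin disj] p(1) by (simp add: power_add)
  qed
  then show ?thesis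
    using gfun_times[OF finite_cores_weight finite_cores_weight, of t "{r}" t R] by metis
qed

section \<open>Core sets within one pair of residue classes\<close>

definition arith_prog :: "nat \<Rightarrow> nat \<Rightarrow> nat \<Rightarrow> nat set" where
  "arith_prog t a m = (\<lambda>k. a + 2 * t * k) ` {..<m}"

lemma inj_on_arith_prog: "(t :: nat) > 0 \<Longrightarrow> inj_on (\<lambda>k. a + 2 * t * k) S"
  by (auto simp: inj_on_def)

lemma card_arith_prog: "t > 0 \<Longrightarrow> card (arith_prog t a m) = m"
  by (simp add: arith_prog_def card_image inj_on_arith_prog)

lemma arith_prog_mod: "a < 2 * t \<Longrightarrow> d \<in> arith_prog t a m \<Longrightarrow> d mod (2 * t) = a"
  by (auto simp: arith_prog_def)

lemma tri_Suc: "tri (int (Suc m)) = tri (int m) + Suc m"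
proof -
  have "2 * int (tri (int (Suc m))) = 2 * int (tri (int m) + Suc m)"
    unfolding of_nat_add distrib_left int_tri by (simp add: algebra_simps)
  then show ?thesis by presburger
qed

lemma tri_minus_Suc: "tri (- int (Suc m)) = tri (- int m) + m"
proof -
  have "2 * int (tri (- int (Suc m))) = 2 * int (tri (- int m) + m)"
    unfolding of_nat_add distrib_left int_tri by (simp add: algebra_simps)
  then show ?thesis by presburger
qed

text \<open>The sum is a m + t m (m - 1), arranged as the exponent of \<open>jterm\<close> for A =
  X^a and B = X^(2t - a).\<close>

lemma sum_arith_prog:
  assumes t: "t > 0" and a: "a \<le> 2 * t"
  shows "\<Sum>(arith_prog t a m) = a * tri (int m) + (2 * t - a) * tri (- int m)"
proof -
  obtain b where b: "2 * t = a + b" using a le_Suc_ex by blast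
  have "\<Sum>(arith_prog t a m) = (\<Sum>k<m. a + 2 * t * k)"
    unfolding arith_prog_def by (subst sum.reindex[OF inj_on_arith_prog[OF t]]) simp
  also have "\<dots> = a * tri (int m) + b * tri (- int m)"
    unfolding b
  proof (induction m)
    case 0
    show ?case by (simp add: tri_def)
  next
    case (Suc m)
    show ?case
      unfolding sum.lessThan_Suc Suc.IH tri_Suc tri_minus_Suc by (simp add: algebra_simps)
  qed
  finally show ?thesis using b by simp
qed

text \<open>Reflection moves the residue \<open>a\<close> to \<open>2 * t - a\<close>, which differs
  from \<open>a\<close> since \<open>a \<noteq> t\<close>.\<close>

lemma arith_prog_core_set:
  assumes a: "odd a" "a < 2 * t" "a \<noteq> t"
  shows "arith_prog t a m \<in> core_sets t"
proof -
  have "hook_core t (arith_prog t a m)"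
    unfolding hook_core_def
  proof (intro ballI conjI impI)
    fix d assume d: "d \<in> arith_prog t a m"
    then obtain k where k: "d = a + 2 * t * k" "k < m" by (auto simp: arith_prog_def)
    show "d - 2 * t \<in> arith_prog t a m" if "2 * t < d"
    proof -
      have "k \<noteq> 0" using that k a by (cases k) auto
      then obtain i where "k = Suc i" by (cases k) auto
      then show ?thesis using k by (auto simp: arith_prog_def)
    qed
    show "2 * t - d \<notin> arith_prog t a m" if "d < 2 * t"
    proof
      assume "2 * t - d \<in> arith_prog t a m"
      then have "(2 * t - d) mod (2 * t) = a" by (rule arith_prog_mod[OF a(2)])
      moreover have "d mod (2 * t) = a" using d by (rule arith_prog_mod[OF a(2)])
      ultimately show False using that a odd_pos by (cases "d = 0") auto
    qed
  qed
  then show ?thesis using a by (auto simp: core_sets_def arith_prog_def)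
qed

lemma core_set_eq_arith_prog:
  assumes D: "D \<in> core_sets t" and a: "0 < a" and t: "t > 0" and m: "\<And>d. d \<in> D \<Longrightarrow> d mod (2 * t) = a"
  shows "D = arith_prog t a (card D)"
proof -
  define K where "K = {k. a + 2 * t * k \<in> D}"
  have DK: "D = (\<lambda>k. a + 2 * t * k) ` K"
  proof
    show "D \<subseteq> (\<lambda>k. a + 2 * t * k) ` K"
    proof
      fix d assume d: "d \<in> D"
      have "d = a + 2 * t * (d div (2 * t))" using m[OF d] by (metis mod_mult_div_eq add.commute)
      then show "d \<in> (\<lambda>k. a + 2 * t * k) ` K" using d by (auto simp: K_def)
    qed
  qed (auto simp: K_def)
  have card: "card D = card K" unfolding DK by (rule card_image[OF inj_on_arith_prog[OF t]])
  have "finite K"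
    using finite_core_set[OF D] unfolding DK by (rule finite_imageD[OF _ inj_on_arith_prog[OF t]])
  moreover have "i \<in> K" if "k \<in> K" "i \<le> k" for i k
    using core_set_descent[OF D _ that(2) a] that(1) by (simp add: K_def)
  ultimately have "K = {..<card K}" by (rule down_closed_eq_lessThan)
  then show ?thesis using DK card by (simp add: arith_prog_def)
qed

text \<open>By descent an occupied class contains its least residue, and \<open>r\<close> and
  \<open>2 * t - r\<close> exclude each other. So at most one of the two classes is occupied: the
  sign of \<open>c\<close> tells which, and its absolute value how many elements.\<close>

definition core_of_int :: "nat \<Rightarrow> nat \<Rightarrow> int \<Rightarrow> nat set" where
  "core_of_int t r c = (if c \<ge> 0 then arith_prog t r (nat c) else arith_prog t (2 * t - r) (nat (- c)))"

lemma bij_betw_core_of_int: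
  assumes r: "odd r" "r < t"
  shows "bij_betw (core_of_int t r) UNIV (cores t {r})"
proof -
  have t: "t > 0" and r0: "0 < r" using r odd_pos by auto
  have c: "card (core_of_int t r c) = nat \<bar>c\<bar>" for c
    using t by (simp add: core_of_int_def card_arith_prog)
  have m1: "d mod (2 * t) = r" if "d \<in> core_of_int t r c" "c \<ge> 0" for c d
    using arith_prog_mod[of r t d] that r by (simp add: core_of_int_def)
  have m2: "d mod (2 * t) = 2 * t - r" if "d \<in> core_of_int t r c" "\<not> c \<ge> 0" for c d
    using arith_prog_mod[of "2 * t - r" t d] that r r0 by (simp add: core_of_int_def)
  have "inj (core_of_int t r)"
  proof (rule injI)
    fix x y assume eq: "core_of_int t r x = core_of_int t r y"
    then have xy: "\<bar>x\<bar> = \<bar>y\<bar>" using c[of x] c[of y] by auto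
    have "False" if "u \<ge> 0" "\<not> v \<ge> 0" "core_of_int t r u = core_of_int t r v" for u v
    proof -
      have "core_of_int t r v \<noteq> {}" using c[of v] that(2) by auto
      then obtain d where "d \<in> core_of_int t r v" by blast
      then have "r = 2 * t - r" using m1[of d u] m2[of d v] that by simp
      then show False using r by simp
    qed
    from this[of x y] this[of y x] show "x = y" using xy eq by (cases "x \<ge> 0"; cases "y \<ge> 0") auto
  qed
  moreover have "core_of_int t r c \<in> cores t {r}" for c
  proof -
    have "core_of_int t r c \<in> core_sets t"
      using r r0 by (auto simp: core_of_int_def intro!: arith_prog_core_set)
    moreover have "fold_residue t d = r" if "d \<in> core_of_int t r c" for d
      using m1[OF that] m2[OF that] r by (cases "c \<ge> 0") (simp_all add: fold_residue_def)
    ultimately show ?thesis by (simp add: cores_def)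
  qed
  moreover have "D \<in> range (core_of_int t r)" if "D \<in> cores t {r}" for D
  proof -
    have D: "D \<in> core_sets t" and res: "d mod (2 * t) = r \<or> d mod (2 * t) = 2 * t - r" if "d \<in> D" for d
      using \<open>D \<in> cores t {r}\<close> that mod_less_divisor[of "2 * t" d] t
      by (auto simp: cores_def fold_residue_def min_def split: if_splits dest!: bspec[OF _ that])
    show ?thesis
    proof (cases "r \<in> D")
      case True
      then have "2 * t - r \<notin> D" using core_setsD(4)[OF _ True] \<open>D \<in> cores t {r}\<close> r by (simp add: cores_def)
      then have "d mod (2 * t) = r" if "d \<in> D" for d
        using res[OF that] core_set_mod[OF D[OF that] that] by auto
      then have "D = arith_prog t r (card D)"
        using \<open>D \<in> cores t {r}\<close> r0 t by (intro core_set_eq_arith_prog) (auto simp: cores_def)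
      then have "D = core_of_int t r (int (card D))" by (simp add: core_of_int_def)
      then show ?thesis by blast
    next
      case False
      then have "d mod (2 * t) = 2 * t - r" if "d \<in> D" for d
        using res[OF that] core_set_mod[OF D[OF that] that] by auto
      then have "D = arith_prog t (2 * t - r) (card D)"
        using \<open>D \<in> cores t {r}\<close> r t by (intro core_set_eq_arith_prog) (auto simp: cores_def)
      then have "D = core_of_int t r (- int (card D))"
        by (auto simp: core_of_int_def arith_prog_def)
      then show ?thesis by blast
    qed
  qed
  ultimately show ?thesis by (auto simp: bij_betw_def)
qed

text \<open>This is r c + t c (c - 1), in a form that covers both signs of \<open>c\<close> with
  natural number coefficients.\<close>

definition core_weight :: "nat \<Rightarrow> nat \<Rightarrow> int \<Rightarrow> nat" where
  "core_weight t r c = r * tri c + (2 * t - r) * tri (- c)"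

lemma core_gf_singleton:
  assumes r: "odd r" "r < t"
  shows "core_gf t {r} = gfun UNIV (core_weight t r) (\<lambda>c. (- 1) ^ nat \<bar>c\<bar>)"
proof (rule gfun_bij_betw[OF bij_betw_core_of_int[OF r], symmetric])
  fix c
  have t: "t > 0" using r by simp
  show "\<Sum>(core_of_int t r c) = core_weight t r c"
    using sum_arith_prog[OF t, of r "nat c"] sum_arith_prog[OF t, of "2 * t - r" "nat (- c)"] r
    by (auto simp: core_of_int_def core_weight_def)
  show "(- 1) ^ card (core_of_int t r c) = ((- 1) ^ nat \<bar>c\<bar> :: rat)"
    using t by (simp add: core_of_int_def card_arith_prog)
qed

text \<open>Both \<open>r\<close> and \<open>2 * t - r\<close> are at least 1, so the weight of
  \<open>c\<close> is at least its absolute value and the window from \<open>-n\<close> to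
  \<open>n\<close> contains every \<open>c\<close> of weight below \<open>n\<close>.\<close>

lemma eqmod_jterm_sum:
  assumes r: "0 < r" "r < t"
  shows "eqmod n (\<Sum>j\<le>2 * n. jterm (fps_X ^ r) (fps_X ^ (2 * t - r)) (int j - int n))
     (gfun UNIV (core_weight t r) (\<lambda>c. (- 1) ^ nat \<bar>c\<bar>) :: rat fps)"
  unfolding eqmod_nth_iff
proof (intro allI impI)
  fix m assume m: "m < n"
  let ?w = "core_weight t r" and ?J = "jterm (fps_X ^ r) (fps_X ^ (2 * t - r)) :: int \<Rightarrow> rat fps"
  have w: "\<bar>c\<bar> \<le> int (?w c)" for c
  proof -
    have "1 * tri c + 1 * tri (- c) \<le> ?w c"
      unfolding core_weight_def using r by (intro add_mono mult_right_mono) auto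
    with abs_le_tri[of c] show ?thesis by linarith
  qed
  have jt: "?J c = fps_const ((- 1) ^ nat \<bar>c\<bar>) * fps_X ^ ?w c" for c
  proof -
    have "(- 1 :: rat fps) ^ k = fps_const ((- 1) ^ k)" for k
      by (induction k) (simp_all add: fps_const_neg[symmetric] del: fps_const_neg)
    then show ?thesis
      by (simp add: jterm_def core_weight_def power_add power_mult mult.assoc)
  qed
  have "fps_nth (\<Sum>j\<le>2 * n. ?J (int j - int n)) m
      = (\<Sum>j\<le>2 * n. if ?w (int j - int n) = m then (- 1) ^ nat \<bar>int j - int n\<bar> else 0)"
    by (auto simp: fps_sum_nth jt fps_X_power_nth intro!: sum.cong)
  also have "\<dots> = (\<Sum>c\<in>{- int n..int n}. if ?w c = m then (- 1) ^ nat \<bar>c\<bar> else 0)"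
  proof (rule sum.reindex_bij_betw)
    show "bij_betw (\<lambda>j. int j - int n) {..2 * n} {- int n..int n}"
      by (rule bij_betw_byWitness[where f' = "\<lambda>c. nat (c + int n)"]) auto
  qed
  also have "\<dots> = (\<Sum>c | c \<in> {- int n..int n} \<and> ?w c = m. (- 1) ^ nat \<bar>c\<bar>)"
    by (rule sum.inter_filter[symmetric]) simp
  also have "{c. c \<in> {- int n..int n} \<and> ?w c = m} = {c. c \<in> UNIV \<and> ?w c = m}"
  proof -
    have "c \<in> {- int n..int n}" if "?w c = m" for c using w[of c] m that by auto
    then show ?thesis by auto
  qed
  finally show "fps_nth (\<Sum>j\<le>2 * n. ?J (int j - int n)) m
    = fps_nth (gfun UNIV ?w (\<lambda>c. (- 1) ^ nat \<bar>c\<bar>)) m"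
    by (simp add: gfun_nth)
qed

section \<open>Collecting the residue classes\<close>

abbreviation residue_factor :: "nat \<Rightarrow> nat \<Rightarrow> nat \<Rightarrow> rat fps" where
  "residue_factor t r k \<equiv> (1 - fps_X ^ (r + 2 * t * k)) * (1 - fps_X ^ (2 * t - r + 2 * t * k))"

lemma eqmod_core_gf:
  assumes "finite R" "\<And>r. r \<in> R \<Longrightarrow> odd r \<and> r < t"
  shows "eqmod n (\<Prod>r\<in>R. qfac (fps_X ^ (2 * t)) n * (\<Prod>k<n. residue_factor t r k)) (core_gf t R)"
  using assms
proof (induction R)
  case empty
  have "core_gf t {} = 1"
    by (rule fps_ext) (simp add: gfun_nth cores_empty conj_commute Collect_conv_if)
  then show ?case by simp
next
  case (insert r R)
  have r: "odd r" "0 < r" "r < t" using insert.prems odd_pos by auto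
  let ?A = "fps_X ^ r :: rat fps" and ?B = "fps_X ^ (2 * t - r) :: rat fps"
  have AB: "?A * ?B = fps_X ^ (2 * t)" using r by (simp flip: power_add)
  have "eqmod n (qfac (?A * ?B) n * (\<Prod>k<n. (1 - ?A * (?A * ?B) ^ k) * (1 - ?B * (?A * ?B) ^ k))) (core_gf t {r})"
    using jacobi_triple_product_mod[of ?A ?B n] eqmod_jterm_sum[OF r(2,3), of n] r
    unfolding core_gf_singleton[OF r(1,3)] by (auto intro: eqmod_trans simp: fps_X_power_nth)
  then have "eqmod n (qfac (fps_X ^ (2 * t)) n * (\<Prod>k<n. residue_factor t r k)) (core_gf t {r})"
    unfolding AB by (simp add: power_add power_mult)
  moreover have "eqmod n (\<Prod>r\<in>R. qfac (fps_X ^ (2 * t)) n * (\<Prod>k<n. residue_factor t r k)) (core_gf t R)"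
    by (rule insert.IH) (use insert.prems in auto)
  ultimately show ?case
    unfolding core_gf_insert[OF insert.hyps(2)] prod.insert[OF insert.hyps] by (rule eqmod_mult)
qed

lemma prod_odd_residues:
  fixes h :: "nat \<Rightarrow> 'a :: comm_monoid_mult"
  shows "(\<Prod>r | odd r \<and> r < t. h r * h (2 * t - r)) * (if odd t then h t else 1) = (\<Prod>i<t. h (2 * i + 1))"
proof -
  let ?R = "{r. odd r \<and> r < t}" and ?S = "{r. odd r \<and> t < r \<and> r < 2 * t}"
  have fin: "finite ?R" "finite ?S" by (auto intro: finite_subset[of _ "{..<2 * t}"])
  have "bij_betw (\<lambda>i. 2 * i + 1) {..<t} {r. odd r \<and> r < 2 * t}"
    by (rule bij_betw_byWitness[where f' = "\<lambda>r. r div 2"]) auto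
  then have "(\<Prod>i<t. h (2 * i + 1)) = (\<Prod>r | odd r \<and> r < 2 * t. h r)"
    by (rule prod.reindex_bij_betw)
  also have "{r. odd r \<and> r < 2 * t} = (?R \<union> ?S) \<union> (if odd t then {t} else {})"
    by (auto simp: odd_pos) (metis linorder_neqE_nat)+
  also have "prod h \<dots> = prod h (?R \<union> ?S) * prod h (if odd t then {t} else {})"
    by (rule prod.union_disjoint) (use fin in auto)
  also have "prod h (?R \<union> ?S) = prod h ?R * prod h ?S"
    by (rule prod.union_disjoint) (use fin in auto)
  also have "prod h ?S = (\<Prod>r\<in>?R. h (2 * t - r))"
  proof -
    have "bij_betw (\<lambda>r. 2 * t - r) ?R ?S"
      by (rule bij_betw_byWitness[where f' = "\<lambda>r. 2 * t - r"]) (auto simp: odd_pos)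
    then show ?thesis by (rule prod.reindex_bij_betw[symmetric])
  qed
  finally show ?thesis by (simp add: prod.distrib)
qed

text \<open>Every odd number below 2 t n is \<open>2 * i + 1 + 2 * t * k\<close> for exactly one
  \<open>i < t\<close> and \<open>k < n\<close>; \<open>prod_odd_residues\<close> sorts the
  \<open>i\<close> into a residue below \<open>t\<close>, a mirror image, or \<open>t\<close>
  itself.\<close>

lemma prod_residue_factors:
  "(\<Prod>r | odd r \<and> r < t. \<Prod>k<n. residue_factor t r k) * (if odd t then \<Prod>k<n. 1 - (fps_X ^ t) ^ (2 * k + 1) else 1)
    = (\<Prod>k<n * t. 1 - fps_X ^ (2 * k + 1))"
proof -
  have "(\<Prod>r | odd r \<and> r < t. \<Prod>k<n. residue_factor t r k) * (if odd t then \<Prod>k<n. 1 - (fps_X ^ t) ^ (2 * k + 1) else 1)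
      = (\<Prod>k<n. (\<Prod>r | odd r \<and> r < t. residue_factor t r k) * (if odd t then 1 - fps_X ^ (t + 2 * t * k) else 1))"
    by (subst prod.swap) (simp add: prod.distrib power_mult[symmetric] algebra_simps del: power_Suc)
  also have "\<dots> = (\<Prod>k<n. \<Prod>i<t. 1 - fps_X ^ (2 * i + 1 + 2 * t * k))"
  proof (rule prod.cong[OF refl])
    fix k
    show "(\<Prod>r | odd r \<and> r < t. residue_factor t r k) * (if odd t then 1 - fps_X ^ (t + 2 * t * k) else 1)
        = (\<Prod>i<t. 1 - fps_X ^ (2 * i + 1 + 2 * t * k))"
      by (rule prod_odd_residues)
  qed
  also have "\<dots> = (\<Prod>k<n. \<Prod>j\<in>{k * t..<k * t + t}. 1 - fps_X ^ (2 * j + 1))"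
  proof (rule prod.cong[OF refl])
    fix k
    have "(\<Prod>j\<in>{0 + k * t..<t + k * t}. 1 - fps_X ^ (2 * j + 1)) = (\<Prod>i\<in>{0..<t}. 1 - fps_X ^ (2 * (i + k * t) + 1) :: rat fps)"
      by (rule prod.shift_bounds_nat_ivl)
    then show "(\<Prod>i<t. 1 - fps_X ^ (2 * i + 1 + 2 * t * k)) = (\<Prod>j\<in>{k * t..<k * t + t}. 1 - fps_X ^ (2 * j + 1) :: rat fps)"
      by (simp add: atLeast0LessThan algebra_simps)
  qed
  also have "\<dots> = (\<Prod>k<n * t. 1 - fps_X ^ (2 * k + 1))"
    by (rule prod.nat_group)
  finally show ?thesis .
qed

lemma card_odd_less: "card {r. odd r \<and> r < t} = t div 2"
proof -
  have "bij_betw (\<lambda>i. 2 * i + 1) {..<t div 2} {r. odd r \<and> r < t}"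
    by (rule bij_betw_byWitness[where f' = "\<lambda>r. r div 2"]) (auto simp: odd_pos, presburger+)
  from bij_betw_same_card[OF this] show ?thesis by simp
qed

abbreviation euler_ratio :: "nat \<Rightarrow> rat fps \<Rightarrow> rat fps" where
  "euler_ratio n Y \<equiv> qfac Y n * inverse (qfac (Y ^ 2) n)"

lemma eqmod_core_gf_all:
  assumes t: "t > 0"
  shows "eqmod n (euler_ratio n fps_X * qfac (fps_X ^ (2 * t)) n ^ (t div 2) *
       (if odd t then qfac (fps_X ^ (2 * t)) n * inverse (qfac (fps_X ^ t) n) else 1))
     (gfun (core_sets t) (\<lambda>D. \<Sum>D) (\<lambda>D. (- 1) ^ card D))"
proof -
  let ?R = "{r. odd r \<and> r < t}" and ?q = "qfac (fps_X ^ (2 * t)) n ^ (t div 2)"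
  let ?P = "\<Prod>r\<in>?R. \<Prod>k<n. residue_factor t r k"
  let ?Y = "fps_X ^ t :: rat fps"
  have Y: "fps_nth ?Y 0 = 0" "fps_nth (?Y ^ 2) 0 = 0" "?Y ^ 2 = fps_X ^ (2 * t)"
    using t by (auto simp: fps_X_power_nth simp flip: power_mult)
  have nt: "n \<le> n * t" using t by simp
  have "eqmod n (?q * ?P) (gfun (core_sets t) (\<lambda>D. \<Sum>D) (\<lambda>D. (- 1) ^ card D))"
  proof -
    have "eqmod n (\<Prod>r\<in>?R. qfac (fps_X ^ (2 * t)) n * (\<Prod>k<n. residue_factor t r k)) (core_gf t ?R)"
      by (rule eqmod_core_gf) auto
    then show ?thesis
      by (simp only: prod.distrib prod_constant card_odd_less cores_all[OF t])
  qed
  moreover have "eqmod n (euler_ratio n fps_X * (if odd t then qfac (fps_X ^ (2 * t)) n * inverse (qfac ?Y n) else 1)) ?P"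
  proof (cases "odd t")
    case False
    then show ?thesis
      using eqmod_sym[OF euler_odd_product_mod[OF _ nt, of fps_X]] prod_residue_factors[of t n] by simp
  next
    case True
    \<comment> \<open>\<open>?O\<close> is the contribution of the class of \<open>t\<close> to the
      full odd product. By Euler's product for \<open>?Y\<close>, \<open>?E\<close> is its inverse
      modulo X^n, so multiplication by \<open>?E\<close> leaves \<open>?P\<close>.\<close>
    let ?O = "\<Prod>k<n. 1 - ?Y ^ (2 * k + 1)" and ?E = "qfac (?Y ^ 2) n * inverse (qfac ?Y n)"
    have "eqmod n (euler_ratio n fps_X * ?E) ((\<Prod>k<n * t. 1 - fps_X ^ (2 * k + 1)) * ?E)"
      by (intro eqmod_mult eqmod_sym[OF euler_odd_product_mod[OF _ nt]] eqmod_refl) simp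
    also have "(\<Prod>k<n * t. 1 - fps_X ^ (2 * k + 1)) * ?E = ?P * (?O * ?E)"
      using prod_residue_factors[of t n] True by (simp add: mult.assoc)
    also have "eqmod n (?P * (?O * ?E)) (?P * (euler_ratio n ?Y * ?E))"
      by (intro eqmod_mult euler_odd_product_mod Y eqmod_refl order_refl)
    also have "euler_ratio n ?Y * ?E = (qfac ?Y n * inverse (qfac ?Y n)) * (qfac (?Y ^ 2) n * inverse (qfac (?Y ^ 2) n))"
      by (simp only: mult_ac)
    also have "\<dots> = 1"
      using Y by (simp add: inverse_mult_eq_1')
    finally show ?thesis using True Y(3) by simp
  qed
  from eqmod_mult[OF eqmod_refl[of n ?q] this]
  have "eqmod n (euler_ratio n fps_X * ?q * (if odd t then qfac (fps_X ^ (2 * t)) n * inverse (qfac ?Y n) else 1)) (?q * ?P)"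
    by (simp only: mult_ac)
  ultimately show ?thesis by (rule eqmod_trans[rotated])
qed

section \<open>Convergence of the product and the sum\<close>

lemma has_prod_fpsI:
  assumes eq: "\<And>n. eqmod n (\<Prod>k<n. f k) G" and one: "\<And>k. fps_nth (f k) 0 = 1"
  shows "f has_prod G"
proof -
  have "fps_nth G 0 = 1"
    using eq[of 1] one[of 0] by (simp add: eqmod_nth_iff)
  \<comment> \<open>\<open>has_prod\<close> with no initial factors removed asks for a nonzero
    limit.\<close>
  then have "G \<noteq> 0" by auto
  moreover have "(\<lambda>n. \<Prod>i\<le>n. f i) \<longlonglongrightarrow> G"
  proof (rule tendsto_fpsI)
    fix m
    have "fps_nth (\<Prod>i\<le>n. f i) m = fps_nth G m" if "m \<le> n" for n
      using eq[of "Suc n"] that by (simp add: eqmod_nth_iff lessThan_Suc_atMost)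
    then show "\<forall>\<^sub>F n in sequentially. fps_nth (\<Prod>i\<le>n. f i) m = fps_nth G m"
      unfolding eventually_sequentially by blast
  qed
  ultimately show ?thesis by (simp add: has_prod_def raw_has_prod_def)
qed

lemma qfac_fps_X_power:
  "qfac (fps_X ^ m) n = (\<Prod>k<n. 1 - fps_X ^ (m * Suc k))"
  by (induction n) (simp_all add: power_mult[symmetric] del: power_Suc)

lemma inverse_qfac_fps_X_power:
  "inverse (qfac (fps_X ^ m) n) = (\<Prod>k<n. inverse (1 - fps_X ^ (m * Suc k)))"
  unfolding qfac_fps_X_power by (induction n) (simp_all add: fps_inverse_mult)

lemma has_sum_SC:
  assumes t: "t > 0"
  shows "((\<lambda>l. of_int (durfee_sign l) * fps_X ^ weight l :: rat fps) has_sum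
     gfun (core_sets t) (\<lambda>D. \<Sum>D) (\<lambda>D. (- 1) ^ card D)) (SC t)"
proof -
  let ?h = self_conj_partition.diag_hooks
  note bij = bij_betw_diag_hooks[OF t]
  have scp: "self_conj_partition l" if "l \<in> SC t" for l
    using that by unfold_locales (auto simp: SC_def is_core_def)
  have nth: "fps_nth (of_int (durfee_sign l) * fps_X ^ weight l :: rat fps) n
      = (if weight l = n then of_int (durfee_sign l) else 0)" for l n
    by (simp add: fps_of_int[symmetric] fps_X_power_nth)
  have gf: "gfun (SC t) weight (\<lambda>l. of_int (durfee_sign l) :: rat) = gfun (core_sets t) (\<lambda>D. \<Sum>D) (\<lambda>D. (- 1) ^ card D)"
    using scp by (intro gfun_bij_betw[OF bij])
      (simp_all add: self_conj_partition.weight_eq durfee_sign_def self_conj_partition.durfee_eq)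
  have supp: "{l \<in> SC t. fps_nth (of_int (durfee_sign l) * fps_X ^ weight l :: rat fps) n \<noteq> 0} = {l \<in> SC t. weight l = n}" for n
    unfolding nth by (auto simp: durfee_sign_def)
  show ?thesis
    unfolding gf[symmetric]
  proof (rule has_sum_fpsI)
    fix n
    \<comment> \<open>Finiteness is transported from core sets, where a given sum bounds every
      element.\<close>
    have "?h ` {l \<in> SC t. weight l = n} \<subseteq> {D \<in> cores t UNIV. \<Sum>D = n}"
      using bij scp self_conj_partition.weight_eq by (fastforce simp: bij_betw_def cores_def)
    then have "finite (?h ` {l \<in> SC t. weight l = n})"
      using finite_cores_weight by (rule finite_subset)
    moreover have "inj_on ?h {l \<in> SC t. weight l = n}"
      using bij by (auto simp: bij_betw_def intro: inj_on_subset)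
    ultimately show "finite {l \<in> SC t. fps_nth (of_int (durfee_sign l) * fps_X ^ weight l :: rat fps) n \<noteq> 0}"
      unfolding supp by (rule finite_imageD)
    show "fps_nth (gfun (SC t) weight (\<lambda>l. of_int (durfee_sign l))) n
       = (\<Sum>l | l \<in> SC t \<and> fps_nth (of_int (durfee_sign l) * fps_X ^ weight l :: rat fps) n \<noteq> 0.
            fps_nth (of_int (durfee_sign l) * fps_X ^ weight l :: rat fps) n)"
      unfolding supp gfun_nth by (intro sum.cong refl) (simp add: nth)
  qed
qed

theorem lemma2p5:
  fixes t t' :: nat
  assumes "t > 0"
  shows
    "(\<lambda>l. of_int (durfee_sign l) * fps_X ^ weight l :: rat fps) summable_on SC t \<and>
     (t = 2 * t' \<longrightarrow>
        convergent_prod (\<lambda>n. let k = Suc n in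
          (1 - fps_X ^ k) / (1 - fps_X ^ (2 * k)) * (1 - fps_X ^ (2 * k * t)) ^ t' :: rat fps) \<and>
        (\<Sum>\<^sub>\<infinity>l\<in>SC t. of_int (durfee_sign l) * fps_X ^ weight l :: rat fps) =
        (\<Prod>n. let k = Suc n in
          (1 - fps_X ^ k) / (1 - fps_X ^ (2 * k)) * (1 - fps_X ^ (2 * k * t)) ^ t')) \<and>
     (t = 2 * t' + 1 \<longrightarrow>
        convergent_prod (\<lambda>n. let k = Suc n in
          (1 - fps_X ^ k) / (1 - fps_X ^ (2 * k)) * (1 - fps_X ^ (2 * k * t)) ^ t' *
          ((1 - fps_X ^ (2 * k * t)) / (1 - fps_X ^ (k * t))) :: rat fps) \<and>
        (\<Sum>\<^sub>\<infinity>l\<in>SC t. of_int (durfee_sign l) * fps_X ^ weight l :: rat fps) =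
        (\<Prod>n. let k = Suc n in
          (1 - fps_X ^ k) / (1 - fps_X ^ (2 * k)) * (1 - fps_X ^ (2 * k * t)) ^ t' *
          ((1 - fps_X ^ (2 * k * t)) / (1 - fps_X ^ (k * t)))))"
proof -
  let ?G = "gfun (core_sets t) (\<lambda>D. \<Sum>D) (\<lambda>D. (- 1) ^ card D) :: rat fps"
  note sum = has_sum_SC[OF assms]
  note G = eqmod_core_gf_all[OF assms]
  \<comment> \<open>The denominators have constant term 1, so division is multiplication by the
    inverse; for \<open>dt\<close> this needs \<open>t > 0\<close>.\<close>
  have d2: "f / (1 - fps_X ^ (2 * Suc k)) = f * inverse (1 - fps_X ^ (2 * Suc k))" for f :: "rat fps" and k
    by (rule fps_divide_unit) simp
  have dt: "f / (1 - fps_X ^ (Suc k * t)) = f * inverse (1 - fps_X ^ (Suc k * t))" for f :: "rat fps" and k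
    by (rule fps_divide_unit) (use assms in \<open>simp add: fps_X_power_nth\<close>)
  have X: "qfac fps_X n = (\<Prod>k<n. 1 - fps_X ^ Suc k :: rat fps)"
    "inverse (qfac (fps_X ^ 2) n) = (\<Prod>k<n. inverse (1 - fps_X ^ (2 * Suc k)) :: rat fps)"
    "qfac (fps_X ^ (2 * t)) n = (\<Prod>k<n. 1 - fps_X ^ (2 * Suc k * t) :: rat fps)"
    "inverse (qfac (fps_X ^ t) n) = (\<Prod>k<n. inverse (1 - fps_X ^ (Suc k * t)) :: rat fps)" for n
    using qfac_fps_X_power[where 'a = rat, of 1 n] qfac_fps_X_power[where 'a = rat, of "2 * t" n]
      inverse_qfac_fps_X_power[where 'a = rat, of _ n]
    by (simp_all only: power_one_right mult_1 mult_ac)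
  have even: "(\<lambda>n. let k = Suc n in
          (1 - fps_X ^ k) / (1 - fps_X ^ (2 * k)) * (1 - fps_X ^ (2 * k * t)) ^ t' :: rat fps) has_prod ?G"
    if t: "t = 2 * t'"
    unfolding Let_def d2
  proof (rule has_prod_fpsI)
    show "eqmod n (\<Prod>k<n. (1 - fps_X ^ Suc k) * inverse (1 - fps_X ^ (2 * Suc k)) * (1 - fps_X ^ (2 * Suc k * t)) ^ t') ?G" for n
    proof -
      have "t div 2 = t'" "\<not> odd t" using t by auto
      with G[of n] show ?thesis by (simp only: X prod.distrib prod_power_distrib if_False mult_1_right)
    qed
  qed (use assms in \<open>simp add: fps_X_power_nth fps_power_zeroth power_0_left\<close>)
  have odd: "(\<lambda>n. let k = Suc n in
          (1 - fps_X ^ k) / (1 - fps_X ^ (2 * k)) * (1 - fps_X ^ (2 * k * t)) ^ t' *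
          ((1 - fps_X ^ (2 * k * t)) / (1 - fps_X ^ (k * t))) :: rat fps) has_prod ?G"
    if t: "t = 2 * t' + 1"
    unfolding Let_def d2 dt
  proof (rule has_prod_fpsI)
    show "eqmod n (\<Prod>k<n. (1 - fps_X ^ Suc k) * inverse (1 - fps_X ^ (2 * Suc k)) * (1 - fps_X ^ (2 * Suc k * t)) ^ t' *
       ((1 - fps_X ^ (2 * Suc k * t)) * inverse (1 - fps_X ^ (Suc k * t)))) ?G" for n
    proof -
      have "t div 2 = t'" "odd t" using t by auto
      with G[of n] show ?thesis by (simp only: X prod.distrib prod_power_distrib not_False_eq_True if_True)
    qed
  qed (use assms in \<open>simp add: fps_X_power_nth fps_power_zeroth power_0_left\<close>)
  have "convergent_prod f \<and> ?G = prodinf f" if "f has_prod ?G" for f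
    using that has_prod_unique[OF that] by (auto simp: convergent_prod_def has_prod_def)
  note conv = this[OF even] this[OF odd]
  show ?thesis
    unfolding infsumI[OF sum] by (intro conjI impI has_sum_imp_summable[OF sum]) (use conv in blast)+
qed

end
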